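(* Let $f\in L^1(\Omega,\mu)$. The following are equivalent: (1) There exist $g\in L^1(\Omega,\mu)$ and a representative $f^\sharp$ of $f$ such that, for $\mu$-almost every $x\in\Omega$ and any $-\tau_-(x)<t_1\le t_2<\tau_+(x)$, $$f^\sharp(\Phi(x,t_1))-f^\sharp(\Phi(x,t_2))=\int_{t_1}^{t_2}g(\Phi(x,s))\,ds .$$ (2) $f\in \mathscr D(\mathcal T_{\max})$. In this case, $g=\mathcal T_{\max}f$.
   Context: Setting. $\mu$ is a positive Radon measure on $\mathbb R^N$ (a Borel measure, or the completion of one, finite on compact sets). $F:\mathbb R^N\to\mathbb R^N$ is a globally Lipschitz vector field. For $x\in\mathbb R^N$, $t\mapsto\Phi(x,t)$, $t\in\mathbb R$, is the unique global solution of $\frac{d}{dt}X(t)=F(X(t))$, $X(0)=x$. Standing assumption: $\mu$ is invariant under the flow, i.e. $\mu(\Phi(A,t))=\mu(A)$ for every measurable $A\subset\mathbb R^N$ and $t\in\mathbb R$. $\Omega\subset\mathbb R^N$ is a (sufficiently smooth) open set. For $x\in\Omega$, $\tau_\pm(x)=\inf\{s>0:\Phi(x,\pm s)\notin\Omega\}$, with $\inf\varnothing=\infty$. Support: the support of a measurable function on $\Omega$ is $\Omega\setminus\omega$, where $\omega$ is the maximal open subset of $\Omega$ on which the function vanishes $\mu$-almost everywhere. Test functions: $\mathfrak Y$ is the set of all measurable bounded functions $\psi:\Omega\to\mathbb R$ (not identified up to $\mu$-a.e. equality) with compact support in $\Omega$ such that for any $x\in\Omega$ the map $s\in(-\tau_-(x),\tau_+(x))\mapsto\psi(\Phi(x,s))$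 is continuously differentiable, and $x\in\Omega\mapsto\frac{d}{ds}\psi(\Phi(x,s))|_{s=0}$ is measurable and bounded. Maximal transport operator: $\mathscr D(\mathcal T_{\max})$ is the set of all $f\in L^1(\Omega,\mu)$ for which there is $g\in L^1(\Omega,\mu)$ with $\int_\Omega g\psi\,d\mu=\int_\Omega f(x)\frac{d}{ds}\psi(\Phi(x,s))|_{s=0}\,d\mu(x)$ for all $\psi\in\mathfrak Y$; then $\mathcal T_{\max}f:=g$. A function $f_2$ on $\Omega$ is a representative of $f_1$ if $f_1=f_2$ $\mu$-almost everywhere. *)

theory Defs
  imports "HOL-Analysis.Analysis"
begin

text \<open>
  A Radon measure on \<open>\<real>\<^sup>N\<close> is a Borel measure, or the completion of one, that is finite on
  compact sets. In both cases ``measurable'' refers to the sigma-algebra \<^term>\<open>sets \<mu>\<close>.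
\<close>

definition radon_measure :: "(real ^ 'n) measure \<Rightarrow> bool" where
  "radon_measure \<mu> \<longleftrightarrow>
     (sets \<mu> = sets borel \<or> (\<exists>\<nu>. sets \<nu> = sets borel \<and> \<mu> = completion \<nu>)) \<and>
     (\<forall>K. compact K \<longrightarrow> emeasure \<mu> K < \<infinity>)"

text \<open>For Lipschitz \<open>F\<close>, this determines \<open>\<Phi>\<close> uniquely.\<close>

definition is_flow :: "(real ^ 'n \<Rightarrow> real ^ 'n) \<Rightarrow> (real ^ 'n \<Rightarrow> real \<Rightarrow> real ^ 'n) \<Rightarrow> bool" where
  "is_flow F \<Phi> \<longleftrightarrow>
     (\<forall>x. \<Phi> x 0 = x \<and> (\<forall>t. (\<Phi> x has_vector_derivative F (\<Phi> x t)) (at t)))"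

definition flow_invariant ::
    "(real ^ 'n) measure \<Rightarrow> (real ^ 'n \<Rightarrow> real \<Rightarrow> real ^ 'n) \<Rightarrow> bool" where
  "flow_invariant \<mu> \<Phi> \<longleftrightarrow>
     (\<forall>A\<in>sets \<mu>. \<forall>t. emeasure \<mu> ((\<lambda>x. \<Phi> x t) ` A) = emeasure \<mu> A)"

definition tau_plus ::
    "(real ^ 'n \<Rightarrow> real \<Rightarrow> real ^ 'n) \<Rightarrow> (real ^ 'n) set \<Rightarrow> real ^ 'n \<Rightarrow> ereal" where
  "tau_plus \<Phi> \<Omega> x = Inf {ereal s | s. s > 0 \<and> \<Phi> x s \<notin> \<Omega>}"

definition tau_minus ::
    "(real ^ 'n \<Rightarrow> real \<Rightarrow> real ^ 'n) \<Rightarrow> (real ^ 'n) set \<Rightarrow> real ^ 'n \<Rightarrow> ereal" where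
  "tau_minus \<Phi> \<Omega> x = Inf {ereal s | s. s > 0 \<and> \<Phi> x (- s) \<notin> \<Omega>}"

text \<open>
  Functions on \<open>\<Omega>\<close> are total functions whose values outside \<open>\<Omega>\<close> are irrelevant. The union below is
  itself an open set on which \<open>\<psi>\<close> vanishes almost everywhere, by second countability.
\<close>

definition ae_support ::
    "(real ^ 'n) measure \<Rightarrow> (real ^ 'n) set \<Rightarrow> (real ^ 'n \<Rightarrow> real) \<Rightarrow> (real ^ 'n) set" where
  "ae_support \<mu> \<Omega> \<psi> = \<Omega> - \<Union>{U. open U \<and> U \<subseteq> \<Omega> \<and> (AE x\<in>U in \<mu>. \<psi> x = 0)}"

definition flow_deriv ::
    "(real ^ 'n \<Rightarrow> real \<Rightarrow> real ^ 'n) \<Rightarrow> (real ^ 'n \<Rightarrow> real) \<Rightarrow> real ^ 'n \<Rightarrow> real" where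
  "flow_deriv \<Phi> \<psi> x = deriv (\<lambda>s. \<psi> (\<Phi> x s)) 0"

definition test_functions ::
    "(real ^ 'n) measure \<Rightarrow> (real ^ 'n \<Rightarrow> real \<Rightarrow> real ^ 'n) \<Rightarrow> (real ^ 'n) set \<Rightarrow>
     (real ^ 'n \<Rightarrow> real) set" where
  "test_functions \<mu> \<Phi> \<Omega> =
     {\<psi>. set_borel_measurable \<mu> \<Omega> \<psi> \<and> bounded (\<psi> ` \<Omega>) \<and> compact (ae_support \<mu> \<Omega> \<psi>) \<and>
         (\<forall>x\<in>\<Omega>. (\<lambda>s. \<psi> (\<Phi> x s)) C1_differentiable_on
                   einterval (- tau_minus \<Phi> \<Omega> x) (tau_plus \<Phi> \<Omega> x)) \<and>
         set_borel_measurable \<mu> \<Omega> (flow_deriv \<Phi> \<psi>) \<and> bounded (flow_deriv \<Phi> \<psi> ` \<Omega>)}"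

definition weak_transport ::
    "(real ^ 'n) measure \<Rightarrow> (real ^ 'n \<Rightarrow> real \<Rightarrow> real ^ 'n) \<Rightarrow> (real ^ 'n) set \<Rightarrow>
     (real ^ 'n \<Rightarrow> real) \<Rightarrow> (real ^ 'n \<Rightarrow> real) \<Rightarrow> bool" where
  "weak_transport \<mu> \<Phi> \<Omega> f g \<longleftrightarrow>
     set_integrable \<mu> \<Omega> g \<and>
     (\<forall>\<psi>\<in>test_functions \<mu> \<Phi> \<Omega>.
        (LINT x:\<Omega>|\<mu>. g x * \<psi> x) = (LINT x:\<Omega>|\<mu>. f x * flow_deriv \<Phi> \<psi> x))"

definition T_max_domain ::
    "(real ^ 'n) measure \<Rightarrow> (real ^ 'n \<Rightarrow> real \<Rightarrow> real ^ 'n) \<Rightarrow> (real ^ 'n) set \<Rightarrow>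
     (real ^ 'n \<Rightarrow> real) set" where
  "T_max_domain \<mu> \<Phi> \<Omega> = {f. set_integrable \<mu> \<Omega> f \<and> (\<exists>g. weak_transport \<mu> \<Phi> \<Omega> f g)}"

text \<open>
  Elements of \<open>L\<^sup>1(\<Omega>, \<mu>)\<close> are represented by functions; \<open>g\<close> is determined only up to equality
  almost everywhere on \<open>\<Omega>\<close>, so \<open>SOME\<close> picks one member of its class.
\<close>

definition T_max ::
    "(real ^ 'n) measure \<Rightarrow> (real ^ 'n \<Rightarrow> real \<Rightarrow> real ^ 'n) \<Rightarrow> (real ^ 'n) set \<Rightarrow>
     (real ^ 'n \<Rightarrow> real) \<Rightarrow> real ^ 'n \<Rightarrow> real" where
  "T_max \<mu> \<Phi> \<Omega> f = (SOME g. weak_transport \<mu> \<Phi> \<Omega> f g)"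

text \<open>
  The integral along a characteristic is taken with respect to Lebesgue (not merely Borel)
  measurable functions: when \<open>\<mu>\<close> is complete, \<open>g\<close> need not be Borel. Its existence is stated
  explicitly, since the library integral of a non-integrable function is \<open>0\<close>.
\<close>

definition integral_along_flow ::
    "(real ^ 'n) measure \<Rightarrow> (real ^ 'n \<Rightarrow> real \<Rightarrow> real ^ 'n) \<Rightarrow> (real ^ 'n) set \<Rightarrow>
     (real ^ 'n \<Rightarrow> real) \<Rightarrow> (real ^ 'n \<Rightarrow> real) \<Rightarrow> bool" where
  "integral_along_flow \<mu> \<Phi> \<Omega> h g \<longleftrightarrow>
     (AE x\<in>\<Omega> in \<mu>. \<forall>t1 t2.
        - tau_minus \<Phi> \<Omega> x < ereal t1 \<and> t1 \<le> t2 \<and> ereal t2 < tau_plus \<Phi> \<Omega> x \<longrightarrow>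
          set_integrable lebesgue {t1..t2} (\<lambda>s. g (\<Phi> x s)) \<and>
          h (\<Phi> x t1) - h (\<Phi> x t2) = (LINT s:{t1..t2}|lebesgue. g (\<Phi> x s)))"

definition representative ::
    "(real ^ 'n) measure \<Rightarrow> (real ^ 'n) set \<Rightarrow> (real ^ 'n \<Rightarrow> real) \<Rightarrow> (real ^ 'n \<Rightarrow> real) \<Rightarrow> bool" where
  "representative \<mu> \<Omega> f1 f2 \<longleftrightarrow> (AE x\<in>\<Omega> in \<mu>. f1 x = f2 x)"

end

theory Submission
  imports Defs
begin

text \<open>
  Functions on \<open>\<Omega>\<close> are extended by zero to the whole space, where the flow is defined for all times
  and preserves the measure. Fubini's theorem and the invariance of the measure turn statements
  about almost every point into statements about almost every time on almost every trajectory, and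
  conversely.

  Suppose that \<open>u\<close> represents \<open>f\<close> and has the increments prescribed by \<open>g\<close>, and let \<open>\<psi>\<close> be a test
  function with derivative \<open>\<psi>'\<close> along the flow. On almost every trajectory, \<open>u * \<psi>\<close> is an indefinite
  integral of \<open>G = u * \<psi>' - g * \<psi>\<close>: inside \<open>\<Omega>\<close> by the product rule, and near the times at which the
  trajectory is outside \<open>\<Omega>\<close> because \<open>\<psi>\<close> has compact support in \<open>\<Omega>\<close>, so that both functions vanish
  (\<open>trajectory_product_rule\<close>). Therefore the increment of \<open>u * \<psi>\<close> from time 0 to time 1 is the
  integral of \<open>G\<close> over this time. Integrated over all starting points, the increment gives 0 and the
  integral gives \<open>\<integral> G\<close>, by invariance. Thus \<open>\<integral> G = 0\<close>, which is the weak equation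
  (\<open>increments_imp_weak\<close>).

  For the converse, averaging a bounded Borel function \<open>\<phi>\<close> twice backwards along the flow, over times
  \<open>h\<close> and \<open>k\<close>, yields a test function provided that \<open>\<phi>\<close> is supported at points whose trajectory stays
  in a compact subset of \<open>\<Omega>\<close> for a time \<open>h + k\<close> (\<open>bwd_bwd_test_function\<close>). Backward averaging is
  adjoint to forward averaging. Since \<open>\<phi>\<close> is arbitrary, the weak equation says that the forward
  average over time \<open>h\<close> of \<open>(\<integral>\<^sub>0\<^sup>k g (\<Phi> x s) ds) - f x + f (\<Phi> x k)\<close> vanishes at almost every
  such point. By Lebesgue's differentiation theorem on trajectories, \<open>h \<rightarrow> 0\<close> removes this average
  (\<open>weak_eq_imp_increment\<close>) and leaves the increment formula for each fixed time \<open>k\<close>, with an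
  exceptional null set that depends on \<open>k\<close>. Dividing by \<open>k \<rightarrow> 0\<close> shows that \<open>f\<close> determines \<open>g\<close>
  (\<open>weak_eq_unique\<close>). Replacing \<open>f\<close> by the pointwise limit \<open>rep f\<close> of its forward averages over
  shrinking times changes \<open>f\<close> only on a null set and gives the formula for all times at once, first
  over short times and then, by additivity, over all of a trajectory inside \<open>\<Omega>\<close>
  (\<open>weak_eq_imp_rep_increments\<close>).
\<close>

section \<open>The flow of a Lipschitz vector field\<close>

text \<open>
  Gronwall's inequality in the form: the squared distance of two solutions, multiplied by
  \<open>exp (- 2 * L * t)\<close>, has a nonpositive derivative.
\<close>

lemma solution_distance_forward:
  fixes X Y :: "real \<Rightarrow> 'a::real_inner"
  assumes F: "L-lipschitz_on UNIV F"
    and X: "\<And>t. (X has_vector_derivative F (X t)) (at t)"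
    and Y: "\<And>t. (Y has_vector_derivative F (Y t)) (at t)"
    and t: "t \<ge> 0"
  shows "dist (X t) (Y t) \<le> exp (L * t) * dist (X 0) (Y 0)"
proof -
  define d where "d s = X s - Y s" for s
  define D where "D s = (d s \<bullet> d s) * exp (- 2 * L * s)" for s
  have d: "(d has_vector_derivative F (X s) - F (Y s)) (at s)" for s
    unfolding d_def by (intro has_vector_derivative_diff X Y)
  have "D t \<le> D 0"
  proof (rule DERIV_nonpos_imp_nonincreasing[OF t])
    fix s
    let ?F = "F (X s) - F (Y s)"
    have "((\<lambda>s. d s \<bullet> d s) has_real_derivative 2 * (d s \<bullet> ?F)) (at s)"
      using has_derivative_inner[OF d[unfolded has_vector_derivative_def] d[unfolded has_vector_derivative_def]]
      unfolding has_field_derivative_def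
      by (rule has_derivative_eq_rhs) (simp add: fun_eq_iff inner_commute[of ?F])
    then have *: "(D has_real_derivative
        2 * (d s \<bullet> ?F) * exp (- 2 * L * s) + (d s \<bullet> d s) * (exp (- 2 * L * s) * (- 2 * L))) (at s)"
      unfolding D_def by (auto intro!: derivative_eq_intros)
    have "d s \<bullet> ?F \<le> norm (d s) * norm ?F"
      by (rule norm_cauchy_schwarz)
    also have "\<dots> \<le> norm (d s) * (L * norm (d s))"
      using lipschitz_onD[OF F, of "X s" "Y s"] by (intro mult_left_mono) (auto simp: dist_norm d_def)
    also have "\<dots> = L * (d s \<bullet> d s)"
      unfolding power2_norm_eq_inner[symmetric] power2_eq_square by (rule mult.left_commute)
    finally have "2 * (d s \<bullet> ?F - L * (d s \<bullet> d s)) * exp (- 2 * L * s) \<le> 0"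
      by (intro mult_nonpos_nonneg[OF mult_nonneg_nonpos]) simp_all
    then show "\<exists>y. (D has_real_derivative y) (at s) \<and> y \<le> 0"
      using * by (intro exI conjI) (assumption, simp add: algebra_simps)
  qed
  then have "d t \<bullet> d t * exp (- 2 * L * t) * exp (2 * L * t) \<le> (d 0 \<bullet> d 0) * exp (2 * L * t)"
    by (intro mult_right_mono) (simp_all add: D_def)
  also have "d t \<bullet> d t * exp (- 2 * L * t) * exp (2 * L * t) = d t \<bullet> d t"
    unfolding mult.assoc by (simp flip: exp_add)
  also have "(d 0 \<bullet> d 0) * exp (2 * L * t) = (exp (L * t) * norm (d 0))\<^sup>2"
    unfolding power_mult_distrib power2_norm_eq_inner mult.assoc exp_double by (rule mult.commute)
  finally have "norm (d t) \<le> exp (L * t) * norm (d 0)"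
    unfolding power2_norm_eq_inner[symmetric] by (rule power2_le_imp_le) simp
  then show ?thesis
    by (simp add: d_def dist_norm)
qed

text \<open>Reversing time turns a solution of \<open>X' = F X\<close> into one of \<open>X' = - F X\<close>.\<close>

lemma solution_distance:
  fixes X Y :: "real \<Rightarrow> 'a::real_inner"
  assumes F: "L-lipschitz_on UNIV F"
    and X: "\<And>t. (X has_vector_derivative F (X t)) (at t)"
    and Y: "\<And>t. (Y has_vector_derivative F (Y t)) (at t)"
  shows "dist (X t) (Y t) \<le> exp (L * \<bar>t\<bar>) * dist (X 0) (Y 0)"
proof (cases "t \<ge> 0")
  case True
  then show ?thesis using solution_distance_forward[OF assms] by simp
next
  case False
  have F': "L-lipschitz_on UNIV (\<lambda>x. - F x)"
    using F by (simp add: lipschitz_on_def dist_minus)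
  have rev: "((\<lambda>t. Z (- t)) has_vector_derivative - F (Z (- t))) (at t)"
    if "\<And>t. (Z has_vector_derivative F (Z t)) (at t)" for Z :: "real \<Rightarrow> 'a" and t
  proof -
    have "(uminus has_vector_derivative (- 1)) (at t)"
      by (auto intro!: derivative_eq_intros)
    from vector_diff_chain_at[OF this, of Z "F (Z (- t))"] that show ?thesis
      by (simp add: o_def)
  qed
  from solution_distance_forward[OF F' rev[OF X] rev[OF Y], of "- t"] False show ?thesis by simp
qed

context
  fixes F :: "'a::euclidean_space \<Rightarrow> 'a" and \<Phi> :: "'a \<Rightarrow> real \<Rightarrow> 'a" and L
  assumes F: "L-lipschitz_on UNIV F"
    and start: "\<And>x. \<Phi> x 0 = x"
    and ode: "\<And>x t. (\<Phi> x has_vector_derivative F (\<Phi> x t)) (at t)"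
begin

text \<open>
  Both sides solve the same initial value problem in \<open>t\<close>.
\<close>

lemma lipschitz_flow_add: "\<Phi> (\<Phi> x s) t = \<Phi> x (s + t)"
proof -
  have "((\<lambda>t. \<Phi> x (s + t)) has_vector_derivative F (\<Phi> x (s + t))) (at t)" for t
  proof -
    have "((+) s has_vector_derivative 1) (at t)"
      by (auto intro!: derivative_eq_intros)
    from vector_diff_chain_at[OF this, of "\<Phi> x" "F (\<Phi> x (s + t))"] ode show ?thesis
      by (simp add: o_def)
  qed
  from solution_distance[OF F ode[of "\<Phi> x s"] this, of t] show ?thesis
    by (simp add: start)
qed

text \<open>
  Trajectories are continuous in time, and nearby trajectories stay close, uniformly on bounded
  time intervals.
\<close>

lemma lipschitz_flow_continuous: "continuous_on UNIV (\<lambda>p. \<Phi> (fst p) (snd p))"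
  unfolding continuous_on_def
proof
  fix p :: "'a \<times> real"
  obtain x t where p: "p = (x, t)" by (cases p)
  have fst_snd: "(fst \<longlongrightarrow> x) (at p)" "(snd \<longlongrightarrow> t) (at p)"
    using tendsto_fst[OF tendsto_ident_at, of p UNIV] tendsto_snd[OF tendsto_ident_at, of p UNIV]
    by (simp_all add: p)
  have cont: "((\<lambda>q. \<Phi> x (snd q)) \<longlongrightarrow> \<Phi> x t) (at p)"
    using has_vector_derivative_continuous[OF ode] fst_snd(2) by (rule isCont_tendsto_compose)
  have "((\<lambda>q. exp (L * \<bar>snd q\<bar>) * dist (fst q) x) \<longlongrightarrow> exp (L * \<bar>t\<bar>) * dist x x) (at p)"
    by (intro tendsto_intros fst_snd)
  then have lim0: "((\<lambda>q. exp (L * \<bar>snd q\<bar>) * dist (fst q) x) \<longlongrightarrow> 0) (at p)"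
    by simp
  have "((\<lambda>q. dist (\<Phi> (fst q) (snd q)) (\<Phi> x (snd q))) \<longlongrightarrow> 0) (at p)"
  proof (rule tendsto_sandwich[OF _ _ tendsto_const lim0])
    show "\<forall>\<^sub>F q in at p. dist (\<Phi> (fst q) (snd q)) (\<Phi> x (snd q)) \<le> exp (L * \<bar>snd q\<bar>) * dist (fst q) x"
      using solution_distance[OF F ode ode] by (intro always_eventually) (metis start)
  qed auto
  from tendsto_add[OF this[unfolded dist_norm tendsto_norm_zero_iff] cont]
  have "((\<lambda>q. \<Phi> (fst q) (snd q)) \<longlongrightarrow> \<Phi> x t) (at p)"
    by simp
  then show "((\<lambda>p. \<Phi> (fst p) (snd p)) \<longlongrightarrow> \<Phi> (fst p) (snd p)) (at p within UNIV)"
    by (simp add: p)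
qed

end

section \<open>Measure-preserving flows\<close>

locale measure_preserving_flow = sigma_finite_measure \<nu>
  for \<nu> :: "'a::euclidean_space measure" +
  fixes \<Phi> :: "'a \<Rightarrow> real \<Rightarrow> 'a"
  assumes sets_eq [measurable_cong]: "sets \<nu> = sets borel"
    and continuous: "continuous_on UNIV (\<lambda>p. \<Phi> (fst p) (snd p))"
    and flow_zero [simp]: "\<Phi> x 0 = x"
    and flow_add [simp]: "\<Phi> (\<Phi> x s) t = \<Phi> x (s + t)"
    and invariant: "A \<in> sets borel \<Longrightarrow> emeasure \<nu> ((\<lambda>x. \<Phi> x t) -` A) = emeasure \<nu> A"
begin

sublocale pair_sigma_finite lborel \<nu> ..

lemma space_eq [simp]: "space \<nu> = UNIV"
  using sets_eq_imp_space_eq[OF sets_eq] by simp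

lemma borel_measurable_flow_measure [simp]: "borel_measurable \<nu> = borel_measurable borel"
  by (rule measurable_cong_sets[OF sets_eq refl])

lemma continuous_on_flow [continuous_intros]:
  assumes "continuous_on S a" "continuous_on S b"
  shows "continuous_on S (\<lambda>z. \<Phi> (a z) (b z))"
  using continuous_on_compose2[OF continuous continuous_on_Pair[OF assms]] by simp

lemma measurable_flow [measurable (raw)]:
  assumes "a \<in> borel_measurable M" "b \<in> borel_measurable M"
  shows "(\<lambda>z. \<Phi> (a z) (b z)) \<in> borel_measurable M"
  using measurable_compose[OF borel_measurable_Pair[OF assms] borel_measurable_continuous_onI[OF continuous]]
  by simp

lemma distr_flow: "distr \<nu> borel (\<lambda>x. \<Phi> x t) = \<nu>"
  by (rule measure_eqI) (auto simp: sets_eq emeasure_distr invariant)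

lemma integrable_flow:
  fixes f :: "'a \<Rightarrow> real"
  assumes "integrable \<nu> f"
  shows "integrable \<nu> (\<lambda>x. f (\<Phi> x t))"
  using integrable_distr[of "\<lambda>x. \<Phi> x t" \<nu> borel f] assms by (simp add: distr_flow)

lemma integral_flow:
  fixes f :: "'a \<Rightarrow> real"
  assumes [measurable]: "f \<in> borel_measurable borel"
  shows "(\<integral>x. f (\<Phi> x t) \<partial>\<nu>) = (\<integral>x. f x \<partial>\<nu>)"
  using integral_distr[of "\<lambda>x. \<Phi> x t" \<nu> borel f] by (simp add: distr_flow)

lemma AE_borel_null_set:
  assumes "AE x in \<nu>. P x"
  obtains N where "N \<in> sets borel" "emeasure \<nu> N = 0" "\<And>x. x \<notin> N \<Longrightarrow> P x"
proof (rule AE_E[OF assms])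
  fix N assume "{x \<in> space \<nu>. \<not> P x} \<subseteq> N" "emeasure \<nu> N = 0" "N \<in> sets \<nu>"
  then show thesis by (intro that[of N]) (auto simp: sets_eq)
qed

lemma AE_flow:
  assumes "AE x in \<nu>. P x"
  shows "AE x in \<nu>. P (\<Phi> x t)"
proof -
  obtain N where N: "N \<in> sets borel" "emeasure \<nu> N = 0" "\<And>x. x \<notin> N \<Longrightarrow> P x"
    by (rule AE_borel_null_set[OF assms]) blast
  have "(\<lambda>x. \<Phi> x t) -` N \<in> sets borel"
    using measurable_sets[of "\<lambda>x. \<Phi> x t" borel borel N] N by simp
  then have "(\<lambda>x. \<Phi> x t) -` N \<in> null_sets \<nu>"
    using N by (auto simp: null_sets_def sets_eq invariant)
  then show ?thesis
    by (rule AE_I') (use N in auto)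
qed

lemma AE_rational_times:
  assumes "AE x in \<nu>. P x"
  shows "AE x in \<nu>. \<forall>q\<in>\<rat>. P (\<Phi> x q)"
  by (subst AE_ball_countable) (auto intro: AE_flow[OF assms] countable_rat)

text \<open>
  Invariance and Fubini's theorem: a null set is met by almost every trajectory at almost no time.
\<close>

lemma AE_almost_all_times:
  assumes "AE x in \<nu>. P x"
  shows "AE x in \<nu>. AE t in lborel. P (\<Phi> x t)"
proof -
  obtain N where N [measurable]: "N \<in> sets borel" and N': "emeasure \<nu> N = 0" "\<And>x. x \<notin> N \<Longrightarrow> P x"
    by (rule AE_borel_null_set[OF assms]) blast
  have "AE x in \<nu>. x \<notin> N"
    by (rule AE_not_in) (use N N' in \<open>auto simp: null_sets_def sets_eq\<close>)
  then have "AE t in lborel. AE x in \<nu>. \<Phi> x t \<notin> N"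
    by (simp add: AE_flow[where P = "\<lambda>x. x \<notin> N"])
  then have "AE x in \<nu>. AE t in lborel. \<Phi> x t \<notin> N"
    by (rule AE_commute[THEN iffD1, rotated]) measurable
  then show ?thesis
    by eventually_elim (use N' in \<open>auto elim!: eventually_mono\<close>)
qed

text \<open>
  By Fubini some time \<open>t\<close> is good for almost every \<open>x\<close>, and the flow backwards by \<open>t\<close> preserves
  null sets.
\<close>

lemma AE_from_almost_all_times:
  assumes P: "Measurable.pred borel P"
    and ae: "AE x in \<nu>. AE t in lborel. P (\<Phi> x t)"
  shows "AE x in \<nu>. P x"
proof -
  have "(\<lambda>p. \<Phi> (snd p) (fst p)) \<in> borel_measurable (lborel \<Otimes>\<^sub>M \<nu>)"
    by measurable
  from measurable_compose[OF this P] have "AE t in lborel. AE x in \<nu>. P (\<Phi> x t)"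
    using ae by (subst AE_commute) (simp_all add: pred_def)
  then obtain t where "AE x in \<nu>. P (\<Phi> x t)"
    using eventually_happens'[of "ae_filter lborel"] by (auto simp: ae_filter_eq_bot_iff)
  from AE_flow[OF this, of "- t"] show ?thesis by simp
qed

end

section \<open>Averages along the flow\<close>

context measure_preserving_flow
begin

text \<open>
  Unnormalized averages over the next, respectively the previous, \<open>h\<close> units of time. As Lebesgue
  integrals of jointly measurable functions they are Borel functions of the starting point.
\<close>

definition fwd :: "real \<Rightarrow> ('a \<Rightarrow> real) \<Rightarrow> 'a \<Rightarrow> real" where
  "fwd h f x = (\<integral>s. indicator {0..h} s * f (\<Phi> x s) \<partial>lborel)"

definition bwd :: "real \<Rightarrow> ('a \<Rightarrow> real) \<Rightarrow> 'a \<Rightarrow> real" where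
  "bwd h f x = (\<integral>s. indicator {0..h} s * f (\<Phi> x (- s)) \<partial>lborel)"

lemma measurable_fwd [measurable (raw)]:
  assumes [measurable]: "f \<in> borel_measurable borel" "h \<in> borel_measurable M" "a \<in> borel_measurable M"
  shows "(\<lambda>z. fwd (h z) f (a z)) \<in> borel_measurable M"
proof -
  have "(\<lambda>z. \<integral>s. indicat_real {z. 0 \<le> snd z \<and> snd z \<le> h (fst z)} (z, s) * f (\<Phi> (a z) s) \<partial>lborel) \<in> borel_measurable M"
    by measurable
  then show ?thesis
    by (simp add: fwd_def indicator_def of_bool_def)
qed

lemma measurable_bwd [measurable]:
  assumes [measurable]: "f \<in> borel_measurable borel"
  shows "bwd h f \<in> borel_measurable borel"
  unfolding bwd_def[abs_def] by measurable

lemma integrable_indicator_Icc: "integrable lborel (indicat_real {a..b::real})"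
  by (rule integrable_real_indicator) (auto simp: emeasure_lborel_Icc_eq)

text \<open>
  Invariance makes the inner integral over \<open>x\<close> independent of \<open>s\<close>.
\<close>

lemma integrable_joint:
  fixes f :: "'a \<Rightarrow> real"
  assumes f: "integrable \<nu> f"
  shows "integrable (lborel \<Otimes>\<^sub>M \<nu>) (\<lambda>(s, x). indicator {a..b} s * f (\<Phi> x s))"
proof -
  have [measurable]: "f \<in> borel_measurable borel"
    using borel_measurable_integrable[OF f] by simp
  have "(\<integral>x. norm (indicat_real {a..b} s * f (\<Phi> x s)) \<partial>\<nu>) = indicator {a..b} s * (\<integral>x. norm (f x) \<partial>\<nu>)" for s
    using integral_flow[of "\<lambda>x. norm (f x)" s] by (simp add: abs_mult)
  then show ?thesis
    by (intro Fubini_integrable AE_I2)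
       (auto intro!: integrable_flow[OF f] integrable_mult_left integrable_indicator_Icc)
qed

text \<open>
  Fubini gives integrability on each of the countably many intervals \<open>{- n..n}\<close>, outside one
  common null set.
\<close>

lemma AE_integrable_along_flow:
  fixes f :: "'a \<Rightarrow> real"
  assumes f: "integrable \<nu> f"
  shows "AE x in \<nu>. \<forall>a b. set_integrable lborel {a..b} (\<lambda>s. f (\<Phi> x s))"
proof -
  have [measurable]: "f \<in> borel_measurable borel"
    using borel_measurable_integrable[OF f] by simp
  have "AE x in \<nu>. set_integrable lborel {- real n..real n} (\<lambda>s. f (\<Phi> x s))" for n
    using AE_integrable_snd[OF integrable_joint[OF f, of "- real n" "real n"]]
    by (simp add: set_integrable_def)
  then have "AE x in \<nu>. \<forall>n. set_integrable lborel {- real n..real n} (\<lambda>s. f (\<Phi> x s))"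
    by (simp add: AE_all_countable)
  then show ?thesis
  proof eventually_elim
    case (elim x)
    show ?case
    proof (intro allI)
      fix a b
      obtain n where n: "max \<bar>a\<bar> \<bar>b\<bar> \<le> real n"
        using real_arch_simple by blast
      show "set_integrable lborel {a..b} (\<lambda>s. f (\<Phi> x s))"
        by (rule set_integrable_subset[OF elim[rule_format, of n]]) (use n in auto)
    qed
  qed
qed

lemma integrable_fwd:
  fixes f :: "'a \<Rightarrow> real"
  assumes f: "integrable \<nu> f"
  shows "integrable \<nu> (fwd h f)"
  unfolding fwd_def[abs_def] using integrable_snd[OF integrable_joint[OF f, of 0 h]] by simp

lemma fwd_eq_integral:
  assumes "set_integrable lborel {t..t + h} (\<lambda>s. f (\<Phi> x s))"
  shows "fwd h f (\<Phi> x t) = integral {t..t + h} (\<lambda>s. f (\<Phi> x s))"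
proof -
  have "integral {t..t + h} (\<lambda>s. f (\<Phi> x s)) = (\<integral>s. indicator {t..t + h} s * f (\<Phi> x s) \<partial>lborel)"
    using set_borel_integral_eq_integral(2)[OF assms] by (simp add: set_lebesgue_integral_def)
  also have "\<dots> = (\<integral>s. indicator {t..t + h} (t + s) * f (\<Phi> x (t + s)) \<partial>lborel)"
    using lborel_integral_real_affine[of 1 "\<lambda>s. indicator {t..t + h} s * f (\<Phi> x s)" t] by simp
  also have "\<dots> = fwd h f (\<Phi> x t)"
    unfolding fwd_def by (intro Bochner_Integration.integral_cong) (auto simp: indicator_def)
  finally show ?thesis by simp
qed

lemma bwd_bounded:
  assumes f: "\<And>x. \<bar>f x\<bar> \<le> B" and h: "h \<ge> 0"
  shows "\<bar>bwd h f x\<bar> \<le> B * h"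
proof -
  have "\<bar>bwd h f x\<bar> \<le> (\<integral>s. \<bar>indicator {0..h} s * f (\<Phi> x (- s))\<bar> \<partial>lborel)"
    unfolding bwd_def by (rule integral_abs_bound)
  also have "\<dots> \<le> (\<integral>s. B * indicator {0..h} s \<partial>lborel)"
    by (rule integral_mono'[OF integrable_mult_right[OF integrable_indicator_Icc]])
       (use f order_trans[OF abs_ge_zero f] in \<open>auto simp: indicator_def\<close>)
  finally show ?thesis using h by simp
qed

text \<open>
  For each fixed \<open>s\<close>, the invariance of \<open>\<nu>\<close> moves the flow by \<open>- s\<close> in one factor to the flow by
  \<open>s\<close> in the other; Fubini's theorem integrates this over \<open>s \<in> {0..h}\<close>.
\<close>

lemma fwd_bwd_adjoint:
  assumes g: "integrable \<nu> g" and [measurable]: "f \<in> borel_measurable borel"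
    and f: "\<And>x. \<bar>f x\<bar> \<le> B"
  shows "(\<integral>x. g x * bwd h f x \<partial>\<nu>) = (\<integral>x. fwd h g x * f x \<partial>\<nu>)"
proof -
  have [measurable]: "g \<in> borel_measurable borel"
    using borel_measurable_integrable[OF g] by simp
  have bound: "\<bar>f x\<bar> \<le> \<bar>B\<bar>" for x
    using f[of x] by linarith
  have swap: "integrable (lborel \<Otimes>\<^sub>M \<nu>) (\<lambda>(s, x). indicator {0..h} s * g (\<Phi> x s) * f x)"
    by (rule Bochner_Integration.integrable_bound
          [OF integrable_mult_right[OF integrable_joint[OF g, of 0 h], of B]])
       (use bound in \<open>auto simp: abs_mult mult.commute[of "\<bar>B\<bar>"] intro!: AE_I2 mult_left_mono\<close>)
  have "integrable (lborel \<Otimes>\<^sub>M \<nu>) (\<lambda>(s, x). indicator {0..h} s * g x)"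
    by (intro Fubini_integrable AE_I2)
       (use g in \<open>auto simp: abs_mult intro!: integrable_mult_left integrable_indicator_Icc\<close>)
  then have swap': "integrable (lborel \<Otimes>\<^sub>M \<nu>) (\<lambda>(s, x). indicator {0..h} s * g x * f (\<Phi> x (- s)))"
    by (rule Bochner_Integration.integrable_bound[OF integrable_mult_right[where c = B]])
       (use bound in \<open>auto simp: abs_mult mult.commute[of "\<bar>B\<bar>"] intro!: AE_I2 mult_left_mono\<close>)
  have "(\<integral>x. g x * bwd h f x \<partial>\<nu>) = (\<integral>x. (\<integral>s. indicator {0..h} s * g x * f (\<Phi> x (- s)) \<partial>lborel) \<partial>\<nu>)"
    unfolding bwd_def by (simp flip: integral_mult_right_zero add: ac_simps)
  also have "\<dots> = (\<integral>s. (\<integral>x. indicator {0..h} s * g x * f (\<Phi> x (- s)) \<partial>\<nu>) \<partial>lborel)"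
    by (rule Fubini_integral[OF swap'])
  also have "\<dots> = (\<integral>s. (\<integral>x. indicator {0..h} s * g (\<Phi> x s) * f x \<partial>\<nu>) \<partial>lborel)"
  proof (rule Bochner_Integration.integral_cong[OF refl])
    fix s
    show "(\<integral>x. indicator {0..h} s * g x * f (\<Phi> x (- s)) \<partial>\<nu>) = (\<integral>x. indicator {0..h} s * g (\<Phi> x s) * f x \<partial>\<nu>)"
      using integral_flow[of "\<lambda>x. indicator {0..h} s * g x * f (\<Phi> x (- s))" s] by auto
  qed
  also have "\<dots> = (\<integral>x. (\<integral>s. indicator {0..h} s * g (\<Phi> x s) * f x \<partial>lborel) \<partial>\<nu>)"
    by (rule Fubini_integral[OF swap, symmetric])
  also have "\<dots> = (\<integral>x. fwd h g x * f x \<partial>\<nu>)"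
    unfolding fwd_def by simp
  finally show ?thesis .
qed

lemma tendsto_iff_Cauchy_lim:
  fixes X :: "nat \<Rightarrow> 'b::{banach}"
  shows "X \<longlonglongrightarrow> l \<longleftrightarrow> Cauchy X \<and> lim X = l"
  using Cauchy_convergent_iff convergent_LIMSEQ_iff limI by metis

text \<open>
  Lebesgue's differentiation theorem on each trajectory gives convergence at almost every time.
\<close>

lemma AE_fwd_differentiation:
  fixes f :: "'a \<Rightarrow> real"
  assumes f: "integrable \<nu> f"
  shows "AE x in \<nu>. (\<lambda>m. real (Suc m) * fwd (1 / real (Suc m)) f x) \<longlonglongrightarrow> f x"
proof (rule AE_from_almost_all_times)
  have [measurable]: "f \<in> borel_measurable borel"
    using borel_measurable_integrable[OF f] by simp
  show "Measurable.pred borel (\<lambda>x. (\<lambda>m. real (Suc m) * fwd (1 / real (Suc m)) f x) \<longlonglongrightarrow> f x)"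
    unfolding tendsto_iff_Cauchy_lim by measurable
  show "AE x in \<nu>. AE t in lborel. (\<lambda>m. real (Suc m) * fwd (1 / real (Suc m)) f (\<Phi> x t)) \<longlonglongrightarrow> f (\<Phi> x t)"
    using AE_integrable_along_flow[OF f]
  proof eventually_elim
    case (elim x)
    note integrable = elim[rule_format]
    let ?u = "\<lambda>s. f (\<Phi> x s)"
    have "?u integrable_on cbox a b" for a b :: real
      using set_borel_integral_eq_integral(1)[of "{a..b}" ?u] elim by simp
    then obtain N where N: "negligible N"
      and lim: "\<And>t e. t \<notin> N \<Longrightarrow> 0 < e \<Longrightarrow> \<exists>d>0. \<forall>h. 0 < h \<and> h < d \<longrightarrow>
        norm (integral (cbox t (t + h *\<^sub>R One)) ?u /\<^sub>R h ^ DIM(real) - ?u t) < e"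
      by (rule integrable_ccontinuous_explicit) blast
    have "AE t in lebesgue. t \<notin> N"
      using N by (intro AE_not_in) (simp add: negligible_iff_null_sets)
    then have "AE t in lborel. t \<notin> N"
      by (simp add: AE_completion_iff)
    then show ?case
    proof eventually_elim
      case (elim t)
      show ?case
      proof (rule LIMSEQ_I)
        fix e :: real assume "e > 0"
        with lim[OF elim] obtain d where "d > 0" and
          d: "\<And>h. 0 < h \<Longrightarrow> h < d \<Longrightarrow> \<bar>integral {t..t + h} ?u / h - ?u t\<bar> < e"
          by (force simp: divide_inverse mult.commute)
        obtain m0 where m0: "1 / real (Suc m0) < d"
          using \<open>d > 0\<close> nat_approx_posE by blast
        have "\<bar>real (Suc m) * fwd (1 / real (Suc m)) f (\<Phi> x t) - ?u t\<bar> < e" if "m \<ge> m0" for m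
        proof -
          have "1 / real (Suc m) \<le> 1 / real (Suc m0)"
            using that by (simp add: field_simps)
          then have "\<bar>integral {t..t + 1 / real (Suc m)} ?u / (1 / real (Suc m)) - ?u t\<bar> < e"
            using m0 by (intro d) auto
          then show ?thesis
            using integrable by (simp add: fwd_eq_integral mult.commute)
        qed
        then show "\<exists>m0. \<forall>m\<ge>m0. norm (real (Suc m) * fwd (1 / real (Suc m)) f (\<Phi> x t) - f (\<Phi> x t)) < e"
          by auto
      qed
    qed
  qed
qed

end

section \<open>Test functions that are averages\<close>

lemma window_integral_eq:
  fixes p :: "real \<Rightarrow> real"
  assumes "\<And>a b. p integrable_on {a..b}" and "a \<le> u - h" "h \<ge> 0"
  shows "integral {u - h..u} p = integral {a..u} p - integral {a..u - h} p"
  using Henstock_Kurzweil_Integration.integral_combine[of a "u - h" u p] assms by simp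

lemma continuous_on_window_integral:
  fixes p :: "real \<Rightarrow> real"
  assumes p: "\<And>a b. p integrable_on {a..b}" and h: "h \<ge> 0"
  shows "continuous_on UNIV (\<lambda>t. integral {t - h..t} p)"
proof (clarsimp simp: continuous_on_eq_continuous_at)
  fix t :: real
  define a where "a = t - 1 - h"
  have I: "continuous_on {a..t + 1} (\<lambda>u. integral {a..u} p)"
    by (rule indefinite_integral_continuous_1[OF p])
  have "continuous_on {t - 1..t + 1} (\<lambda>u. integral {a..u} p - integral {a..u - h} p)"
    by (intro continuous_on_diff continuous_on_compose2[OF I] continuous_intros) (use h in \<open>auto simp: a_def\<close>)
  then have "continuous_on {t - 1..t + 1} (\<lambda>u. integral {u - h..u} p)"
    by (rule continuous_on_eq) (use h p in \<open>auto simp: a_def window_integral_eq[of p "t - 1 - h"]\<close>)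
  then show "isCont (\<lambda>u. integral {u - h..u} p) t"
    by (rule continuous_on_interior) simp
qed

lemma has_real_derivative_window_integral:
  fixes p :: "real \<Rightarrow> real"
  assumes p: "continuous_on UNIV p" and h: "h \<ge> 0"
  shows "((\<lambda>t. integral {t - h..t} p) has_real_derivative p t - p (t - h)) (at t)"
proof -
  define a where "a = t - 1 - h"
  have pint: "p integrable_on {c..d}" for c d
    by (intro integrable_continuous_interval continuous_on_subset[OF p]) simp
  have I: "((\<lambda>u. integral {a..u} p) has_real_derivative p s) (at s)" if "a < s" "s < t + 1" for s
  proof -
    have "((\<lambda>u. integral {a..u} p) has_real_derivative p s) (at s within {a..t + 1})"
      by (intro integral_has_real_derivative continuous_on_subset[OF p]) (use that in auto)
    then show ?thesis using that by (simp add: at_within_Icc_at)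
  qed
  have shift: "((\<lambda>u. integral {a..u - h} p) has_real_derivative p (t - h)) (at t)"
    using DERIV_shift[of "\<lambda>u. integral {a..u} p" "p (t - h)" t "- h"] I[of "t - h"] h by (simp add: a_def)
  have "((\<lambda>u. integral {a..u} p - integral {a..u - h} p) has_real_derivative p t - p (t - h)) (at t)"
    by (intro DERIV_diff I shift) (use h in \<open>auto simp: a_def\<close>)
  then show ?thesis
  proof (rule DERIV_cong_ev[OF refl _ refl, THEN iffD1, rotated])
    have "eventually (\<lambda>u. u \<in> {t - 1<..<t + 1}) (nhds t)"
      by (intro eventually_nhds_in_open) auto
    then show "\<forall>\<^sub>F u in nhds t. integral {a..u} p - integral {a..u - h} p = integral {u - h..u} p"
      by eventually_elim (use h pint in \<open>auto simp: a_def window_integral_eq[of p "t - 1 - h"]\<close>)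
  qed
qed

context measure_preserving_flow
begin

lemma bounded_integrable_along_flow:
  fixes f :: "'a \<Rightarrow> real"
  assumes [measurable]: "f \<in> borel_measurable borel" and f: "\<And>x. \<bar>f x\<bar> \<le> B"
  shows "set_integrable lborel {a..b} (\<lambda>s. f (\<Phi> x s))"
  unfolding set_integrable_def
  by (rule Bochner_Integration.integrable_bound[OF integrable_mult_right[where c = B, OF integrable_indicator_Icc[of a b]]])
     (use f order_trans[OF f abs_ge_self] in \<open>auto simp: indicator_def intro!: AE_I2\<close>)

text \<open>
  Along a trajectory a backward average is an integral over a window of constant length that slides
  with time.
\<close>

lemma bwd_eq_integral:
  fixes f :: "'a \<Rightarrow> real"
  assumes [measurable]: "f \<in> borel_measurable borel" and f: "\<And>x. \<bar>f x\<bar> \<le> B"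
  shows "bwd h f (\<Phi> x t) = integral {t - h..t} (\<lambda>s. f (\<Phi> x s))"
proof -
  have "integral {t - h..t} (\<lambda>s. f (\<Phi> x s)) = (\<integral>s. indicator {t - h..t} s * f (\<Phi> x s) \<partial>lborel)"
    using set_borel_integral_eq_integral(2)[OF bounded_integrable_along_flow[OF assms]]
    by (simp add: set_lebesgue_integral_def)
  also have "\<dots> = (\<integral>s. indicator {t - h..t} (t - s) * f (\<Phi> x (t - s)) \<partial>lborel)"
    using lborel_integral_real_affine[of "- 1" "\<lambda>s. indicator {t - h..t} s * f (\<Phi> x s)" t] by simp
  also have "\<dots> = bwd h f (\<Phi> x t)"
    unfolding bwd_def by (intro Bochner_Integration.integral_cong) (auto simp: indicator_def)
  finally show ?thesis by simp
qed

text \<open>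
  Averaging twice produces functions that are \<open>C\<^sup>1\<close> along every trajectory, whatever the Borel
  function one starts with: the first average is continuous along trajectories, and the second is
  then differentiable by the fundamental theorem of calculus.
\<close>

lemma bwd_bwd_derivative:
  fixes f :: "'a \<Rightarrow> real"
  assumes [measurable]: "f \<in> borel_measurable borel" and f: "\<And>x. \<bar>f x\<bar> \<le> B" and "h \<ge> 0" "k \<ge> 0"
  shows "((\<lambda>t. bwd k (bwd h f) (\<Phi> x t)) has_real_derivative
            bwd h f (\<Phi> x t) - bwd h f (\<Phi> x (t - k))) (at t)"
    and "continuous_on UNIV (\<lambda>t. bwd h f (\<Phi> x t))"
proof -
  show cont: "continuous_on UNIV (\<lambda>t. bwd h f (\<Phi> x t))"
    unfolding bwd_eq_integral[OF assms(1,2)]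
    by (intro continuous_on_window_integral \<open>h \<ge> 0\<close> set_borel_integral_eq_integral(1)
          bounded_integrable_along_flow[OF assms(1,2)])
  show "((\<lambda>t. bwd k (bwd h f) (\<Phi> x t)) has_real_derivative
            bwd h f (\<Phi> x t) - bwd h f (\<Phi> x (t - k))) (at t)"
    unfolding bwd_eq_integral[OF measurable_bwd[OF assms(1)] bwd_bounded[OF f \<open>h \<ge> 0\<close>], of k]
    by (rule has_real_derivative_window_integral[OF cont \<open>k \<ge> 0\<close>])
qed

end

text \<open>
  The measure \<open>\<nu>\<close> is the Borel measure underlying \<open>\<mu>\<close>. The arguments run over \<open>\<nu>\<close>, because for a
  Borel function \<open>f\<close> the map \<open>(x, t) \<mapsto> f (\<Phi> x t)\<close> is jointly measurable, as Fubini's theorem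
  requires. Functions on \<open>\<Omega>\<close> are replaced by Borel functions on the whole space that vanish almost
  everywhere outside \<open>\<Omega>\<close>.
\<close>

locale transport_domain = measure_preserving_flow \<nu> \<Phi>
  for \<nu> :: "(real ^ 'n) measure" and \<Phi> +
  fixes \<mu> :: "(real ^ 'n) measure" and \<Omega> :: "(real ^ 'n) set"
  assumes measure_cases: "\<mu> = \<nu> \<or> \<mu> = completion \<nu>"
    and open_domain: "open \<Omega>"
begin

lemma AE_iff: "(AE x in \<mu>. P x) \<longleftrightarrow> (AE x in \<nu>. P x)"
  using measure_cases by (auto simp: AE_completion_iff)

lemma domain_borel [measurable]: "\<Omega> \<in> sets borel"
  using open_domain by simp

lemma borel_measurable_imp:
  fixes f :: "real ^ 'n \<Rightarrow> real"
  shows "f \<in> borel_measurable borel \<Longrightarrow> f \<in> borel_measurable \<mu>"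
  using measure_cases by (auto intro: measurable_completion)

lemma integrable_iff:
  fixes f :: "real ^ 'n \<Rightarrow> real"
  shows "f \<in> borel_measurable borel \<Longrightarrow> integrable \<mu> f \<longleftrightarrow> integrable \<nu> f"
  using measure_cases by (auto simp: integrable_completion)

lemma integral_eq:
  fixes f :: "real ^ 'n \<Rightarrow> real"
  shows "f \<in> borel_measurable borel \<Longrightarrow> integral\<^sup>L \<mu> f = integral\<^sup>L \<nu> f"
  using measure_cases by (auto simp: integral_completion)

lemma borel_version:
  fixes f :: "real ^ 'n \<Rightarrow> real"
  assumes "set_borel_measurable \<mu> \<Omega> f"
  obtains f' where "f' \<in> borel_measurable borel" "AE x in \<nu>. f' x = indicator \<Omega> x * f x"
proof -
  have "\<exists>f'\<in>borel_measurable borel. AE x in \<nu>. indicator \<Omega> x * f x = f' x"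
    using measure_cases assms completion_ex_borel_measurable_real[of "\<lambda>x. indicator \<Omega> x * f x" \<nu>]
    by (auto simp: set_borel_measurable_def)
  then show thesis using that by (auto simp: eq_commute)
qed

lemma integrable_borel_version:
  fixes f :: "real ^ 'n \<Rightarrow> real"
  assumes f: "set_integrable \<mu> \<Omega> f"
  obtains f' where "integrable \<nu> f'" "AE x in \<nu>. f' x = indicator \<Omega> x * f x"
proof -
  have meas: "(\<lambda>x. indicator \<Omega> x *\<^sub>R f x) \<in> borel_measurable \<mu>"
    using f by (auto simp: set_integrable_def)
  then have "set_borel_measurable \<mu> \<Omega> f"
    by (simp add: set_borel_measurable_def)
  then obtain f' where f': "f' \<in> borel_measurable borel" "AE x in \<nu>. f' x = indicator \<Omega> x * f x"
    by (rule borel_version) blast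
  have "integrable \<mu> f'"
    by (rule integrable_cong_AE_imp[OF f[unfolded set_integrable_def]])
       (use f' in \<open>auto intro: borel_measurable_imp simp: AE_iff\<close>)
  then show thesis using that f' by (simp add: integrable_iff)
qed

text \<open>
  If every forward trajectory of length \<open>e\<close> starting in \<open>K\<close> stays in the compact set \<open>C\<close>, then
  two averages of total length at most \<open>e\<close> of a function supported in \<open>K\<close> are supported in \<open>C\<close>.
\<close>

lemma bwd_bwd_test_function:
  fixes f :: "real ^ 'n \<Rightarrow> real"
  assumes [measurable]: "f \<in> borel_measurable borel" and f: "\<And>x. \<bar>f x\<bar> \<le> B"
    and hk: "h \<ge> 0" "k \<ge> 0" "h + k \<le> e"
    and C: "compact C" "C \<subseteq> \<Omega>"
    and K: "\<And>x s. f x \<noteq> 0 \<Longrightarrow> 0 \<le> s \<Longrightarrow> s \<le> e \<Longrightarrow> \<Phi> x s \<in> C"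
  shows "bwd k (bwd h f) \<in> test_functions \<mu> \<Phi> \<Omega>"
    and "flow_deriv \<Phi> (bwd k (bwd h f)) x = bwd h f x - bwd h f (\<Phi> x (- k))"
proof -
  define \<psi> where "\<psi> = bwd k (bwd h f)"
  note deriv = bwd_bwd_derivative[OF assms(1,2) hk(1,2), folded \<psi>_def]
  have flow_deriv: "flow_deriv \<Phi> \<psi> x = bwd h f x - bwd h f (\<Phi> x (- k))" for x
    using DERIV_imp_deriv[OF deriv(1)[of x 0]] by (simp add: flow_deriv_def)
  then show "flow_deriv \<Phi> (bwd k (bwd h f)) x = bwd h f x - bwd h f (\<Phi> x (- k))"
    by (simp add: \<psi>_def)
  have [measurable]: "\<psi> \<in> borel_measurable borel"
    unfolding \<psi>_def by measurable
  have [measurable]: "flow_deriv \<Phi> \<psi> \<in> borel_measurable borel"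
    unfolding flow_deriv[abs_def] by measurable
  have bound1: "\<bar>bwd h f x\<bar> \<le> B * h" for x
    by (rule bwd_bounded[OF f hk(1)])
  have bound2: "\<bar>\<psi> x\<bar> \<le> B * h * k" for x
    unfolding \<psi>_def by (rule bwd_bounded[OF bound1 hk(2)])
  have bound3: "\<bar>flow_deriv \<Phi> \<psi> x\<bar> \<le> 2 * (B * h)" for x
    using bound1[of x] bound1[of "\<Phi> x (- k)"] unfolding flow_deriv by linarith
  have vanish: "\<psi> x = 0" if "x \<notin> C" for x
  proof -
    have "f (\<Phi> x (- r - s)) = 0" if "r \<in> {0..k}" "s \<in> {0..h}" for r s
    proof (rule ccontr)
      assume "f (\<Phi> x (- r - s)) \<noteq> 0"
      from K[OF this, of "r + s"] that hk \<open>x \<notin> C\<close> show False by simp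
    qed
    then have zero: "indicator {0..k} r * bwd h f (\<Phi> x (- r)) = 0" for r
      unfolding bwd_def by (cases "r \<in> {0..k}") (auto simp: indicator_def intro!: integral_eq_zero_AE)
    then show ?thesis
      unfolding \<psi>_def bwd_def[of k] by (simp only: zero) simp
  qed
  have "ae_support \<mu> \<Omega> \<psi> = C - \<Union>{U. open U \<and> U \<subseteq> \<Omega> \<and> (AE x\<in>U in \<mu>. \<psi> x = 0)}"
  proof -
    have "open (\<Omega> - C)" "AE x\<in>\<Omega> - C in \<mu>. \<psi> x = 0"
      using open_domain compact_imp_closed[OF C(1)] vanish by auto
    then show ?thesis
      unfolding ae_support_def using C(2) by auto
  qed
  then have supp: "compact (ae_support \<mu> \<Omega> \<psi>)"
    using C(1) by (auto intro!: compact_diff)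
  have C1: "(\<lambda>t. \<psi> (\<Phi> x t)) C1_differentiable_on A" for x A
    unfolding C1_differentiable_on_def
  proof (intro exI conjI ballI)
    show "((\<lambda>t. \<psi> (\<Phi> x t)) has_vector_derivative bwd h f (\<Phi> x t) - bwd h f (\<Phi> x (t - k))) (at t)" for t
      using deriv(1) by (simp add: has_real_derivative_iff_has_vector_derivative)
    show "continuous_on A (\<lambda>t. bwd h f (\<Phi> x t) - bwd h f (\<Phi> x (t - k)))"
      by (intro continuous_on_diff continuous_on_compose2[OF deriv(2)] continuous_intros) auto
  qed
  have meas: "set_borel_measurable \<mu> \<Omega> q" if [measurable]: "q \<in> borel_measurable borel" for q :: "real ^ 'n \<Rightarrow> real"
    unfolding set_borel_measurable_def by (intro borel_measurable_imp) measurable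
  have "bounded (\<psi> ` \<Omega>)" "bounded (flow_deriv \<Phi> \<psi> ` \<Omega>)"
    using bound2 bound3 by (auto simp: bounded_iff)
  then have "\<psi> \<in> test_functions \<mu> \<Phi> \<Omega>"
    unfolding test_functions_def using supp C1 by (auto intro!: meas)
  then show "bwd k (bwd h f) \<in> test_functions \<mu> \<Phi> \<Omega>"
    by (simp add: \<psi>_def)
qed

end

section \<open>From the weak formulation to increments along trajectories\<close>

context transport_domain
begin

text \<open>
  Points whose forward trajectory remains in \<open>C\<close> during \<open>e\<close> units of time. Averages of total length
  at most \<open>e\<close> of a function supported here are test functions if \<open>C\<close> is a compact subset of \<open>\<Omega>\<close>.
\<close>

definition stays :: "(real ^ 'n) set \<Rightarrow> real \<Rightarrow> (real ^ 'n) set" where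
  "stays C e = {x. \<forall>s\<in>{0..e}. \<Phi> x s \<in> C}"

lemma closed_stays:
  assumes "closed C"
  shows "closed (stays C e)"
proof -
  have "stays C e = (\<Inter>s\<in>{0..e}. (\<lambda>x. \<Phi> x s) -` C)"
    by (auto simp: stays_def)
  then show ?thesis
    by (auto intro!: closed_INT continuous_closed_vimage assms
          continuous_on_flow[of UNIV, THEN continuous_on_eq_continuous_at[THEN iffD1, OF open_UNIV, THEN bspec]]
          continuous_intros)
qed

text \<open>
  The weak equation for functions on the whole space, tested with Borel functions, such as the
  averages constructed above.
\<close>

definition weak_eq :: "(real ^ 'n \<Rightarrow> real) \<Rightarrow> (real ^ 'n \<Rightarrow> real) \<Rightarrow> bool" where
  "weak_eq f g \<longleftrightarrow> integrable \<nu> f \<and> integrable \<nu> g \<and>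
     (\<forall>\<psi>\<in>test_functions \<mu> \<Phi> \<Omega>. \<psi> \<in> borel_measurable borel \<longrightarrow>
        flow_deriv \<Phi> \<psi> \<in> borel_measurable borel \<longrightarrow>
        (\<integral>x. g x * \<psi> x \<partial>\<nu>) = (\<integral>x. f x * flow_deriv \<Phi> \<psi> x \<partial>\<nu>))"

text \<open>
  For the test function \<open>bwd k (bwd h \<phi>)\<close>, both averages can be moved by adjointness to the other
  factor. With \<open>D\<close> the function averaged in the conclusion, the weak equation turns into
  \<open>\<integral> fwd h D * \<phi> = 0\<close> for every bounded Borel function \<open>\<phi>\<close> supported in \<open>stays C e\<close>.
\<close>

lemma weak_eq_imp_increment_average:
  assumes weak: "weak_eq f g" and C: "compact C" "C \<subseteq> \<Omega>"
    and hk: "0 \<le> h" "0 \<le> k" "h + k \<le> e"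
  shows "AE x in \<nu>. x \<in> stays C e \<longrightarrow> fwd h (\<lambda>x. fwd k g x - f x + f (\<Phi> x k)) x = 0"
proof -
  define D where "D x = fwd k g x - f x + f (\<Phi> x k)" for x
  have f: "integrable \<nu> f" and g: "integrable \<nu> g"
    using weak by (auto simp: weak_eq_def)
  have [measurable]: "f \<in> borel_measurable borel" "g \<in> borel_measurable borel"
    using borel_measurable_integrable[OF f] borel_measurable_integrable[OF g] by simp_all
  have D: "integrable \<nu> D"
    unfolding D_def[abs_def]
    by (intro Bochner_Integration.integrable_add Bochner_Integration.integrable_diff integrable_fwd integrable_flow f g)
  have [measurable]: "D \<in> borel_measurable borel"
    using borel_measurable_integrable[OF D] by simp
  have [measurable]: "stays C e \<in> sets borel"
    using closed_stays[OF compact_imp_closed[OF C(1)]] by simp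
  \<comment> \<open>With this choice the integrand \<open>fwd h D * \<phi>\<close> is \<open>\<bar>fwd h D\<bar>\<close> on \<open>stays C e\<close>.\<close>
  define \<phi> where "\<phi> x = indicator (stays C e) x * sgn (fwd h D x)" for x
  have \<phi> [measurable]: "\<phi> \<in> borel_measurable borel"
    unfolding \<phi>_def by measurable
  have \<phi>_le: "\<bar>\<phi> x\<bar> \<le> 1" for x
    by (auto simp: \<phi>_def indicator_def sgn_if)
  have \<phi>_stays: "\<Phi> x s \<in> C" if "\<phi> x \<noteq> 0" "0 \<le> s" "s \<le> e" for x s
    using that by (auto simp: \<phi>_def stays_def indicator_def split: if_splits)
  define b where "b = bwd h \<phi>"
  have b [measurable]: "b \<in> borel_measurable borel"
    unfolding b_def by measurable
  have b_le: "\<bar>b x\<bar> \<le> h" for x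
    using bwd_bounded[of \<phi> 1 h x, OF \<phi>_le hk(1)] by (simp add: b_def)
  have times_b: "integrable \<nu> (\<lambda>x. u x * b x)" if u: "integrable \<nu> u" for u
  proof (rule Bochner_Integration.integrable_bound[OF integrable_mult_left[OF u, of h]])
    have [measurable]: "u \<in> borel_measurable borel"
      using borel_measurable_integrable[OF u] by simp
    show "(\<lambda>x. u x * b x) \<in> borel_measurable \<nu>"
      by simp
    show "AE x in \<nu>. norm (u x * b x) \<le> norm (u x * h)"
      using b_le hk(1) by (auto simp: abs_mult intro!: AE_I2 mult_left_mono)
  qed
  have test: "bwd k b \<in> test_functions \<mu> \<Phi> \<Omega>" "flow_deriv \<Phi> (bwd k b) x = b x - b (\<Phi> x (- k))" for x
    unfolding b_def by (rule bwd_bwd_test_function[OF \<phi> \<phi>_le hk C \<phi>_stays]; assumption)+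
  have [measurable]: "bwd k b \<in> borel_measurable borel"
    by measurable
  have "flow_deriv \<Phi> (bwd k b) \<in> borel_measurable borel"
    unfolding test(2)[abs_def] by measurable
  then have "(\<integral>x. g x * bwd k b x \<partial>\<nu>) = (\<integral>x. f x * (b x - b (\<Phi> x (- k))) \<partial>\<nu>)"
    using weak test by (auto simp: weak_eq_def)
  also have "(\<integral>x. g x * bwd k b x \<partial>\<nu>) = (\<integral>x. fwd k g x * b x \<partial>\<nu>)"
    by (rule fwd_bwd_adjoint[OF g b b_le])
  also have "(\<integral>x. f x * (b x - b (\<Phi> x (- k))) \<partial>\<nu>) = (\<integral>x. f x * b x \<partial>\<nu>) - (\<integral>x. f x * b (\<Phi> x (- k)) \<partial>\<nu>)"
    using times_b[OF f] integrable_flow[OF times_b[OF integrable_flow[OF f, of k]], of "- k"]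
    by (simp add: right_diff_distrib)
  also have "(\<integral>x. f x * b (\<Phi> x (- k)) \<partial>\<nu>) = (\<integral>x. f (\<Phi> x k) * b x \<partial>\<nu>)"
    using integral_flow[of "\<lambda>x. f (\<Phi> x k) * b x" "- k"] by simp
  finally have "(\<integral>x. D x * b x \<partial>\<nu>) = 0"
    using times_b[OF integrable_fwd[OF g]] times_b[OF f] times_b[OF integrable_flow[OF f]]
    by (simp add: D_def distrib_right left_diff_distrib)
  then have "(\<integral>x. fwd h D x * \<phi> x \<partial>\<nu>) = 0"
    using fwd_bwd_adjoint[OF D \<phi> \<phi>_le, of h] by (simp add: b_def)
  also have "(\<lambda>x. fwd h D x * \<phi> x) = (\<lambda>x. indicator (stays C e) x * \<bar>fwd h D x\<bar>)"
    by (auto simp: \<phi>_def abs_sgn mult_ac)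
  finally have "(\<integral>x. indicator (stays C e) x * \<bar>fwd h D x\<bar> \<partial>\<nu>) = 0" .
  moreover have "integrable \<nu> (\<lambda>x. indicator (stays C e) x * \<bar>fwd h D x\<bar>)"
    by (rule Bochner_Integration.integrable_bound[OF integrable_fwd[OF D, of h]])
       (auto simp: indicator_def)
  ultimately have "AE x in \<nu>. indicator (stays C e) x * \<bar>fwd h D x\<bar> = 0"
    by (subst (asm) integral_nonneg_eq_0_iff_AE) auto
  then show ?thesis
    unfolding D_def[abs_def, symmetric] by eventually_elim (auto simp: indicator_def)
qed

text \<open>Dividing by \<open>h\<close> and letting it tend to \<open>0\<close> removes one of the two averages.\<close>

lemma weak_eq_imp_increment:
  assumes weak: "weak_eq f g" and C: "compact C" "C \<subseteq> \<Omega>" and k: "0 \<le> k" "k < e"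
  shows "AE x in \<nu>. x \<in> stays C e \<longrightarrow> f x - f (\<Phi> x k) = fwd k g x"
proof -
  define D where "D x = fwd k g x - f x + f (\<Phi> x k)" for x
  have D: "integrable \<nu> D"
    unfolding D_def[abs_def] using weak
    by (intro Bochner_Integration.integrable_add Bochner_Integration.integrable_diff integrable_fwd integrable_flow)
       (auto simp: weak_eq_def)
  obtain m0 where m0: "1 / real (Suc m0) < e - k"
    using k nat_approx_posE[of "e - k"] by auto
  have small: "1 / real (Suc m) + k \<le> e" if "m \<ge> m0" for m
  proof -
    have "1 / real (Suc m) \<le> 1 / real (Suc m0)"
      using that by (simp add: field_simps)
    then show ?thesis using m0 by linarith
  qed
  have "AE x in \<nu>. \<forall>m. m \<ge> m0 \<longrightarrow> x \<in> stays C e \<longrightarrow> fwd (1 / real (Suc m)) D x = 0"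
    unfolding AE_all_countable D_def[abs_def]
  proof
    fix m show "AE x in \<nu>. m \<ge> m0 \<longrightarrow> x \<in> stays C e \<longrightarrow>
        fwd (1 / real (Suc m)) (\<lambda>x. fwd k g x - f x + f (\<Phi> x k)) x = 0"
      using weak_eq_imp_increment_average[OF weak C _ k(1) small, of m] by (cases "m \<ge> m0") auto
  qed
  with AE_fwd_differentiation[OF D] show ?thesis
  proof eventually_elim
    case (elim x)
    show ?case
    proof
      assume "x \<in> stays C e"
      then have "\<forall>\<^sub>F m in sequentially. real (Suc m) * fwd (1 / real (Suc m)) D x = 0"
        using elim(2) by (auto simp: eventually_sequentially)
      from tendsto_cong[OF this] elim(1) have "(\<lambda>_::nat. 0) \<longlonglongrightarrow> D x"
        by simp
      then have "D x = 0"
        by (simp add: LIMSEQ_const_iff)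
      then show "f x - f (\<Phi> x k) = fwd k g x"
        by (simp add: D_def)
    qed
  qed
qed

text \<open>
  Compact sets exhausting \<open>\<Omega>\<close>, with shorter and shorter times to be spent in them: a compact piece of
  a trajectory inside \<open>\<Omega>\<close> eventually lies in \<open>C n\<close>, so all its points, except those within
  \<open>1 / Suc n\<close> of its end, belong to \<open>stays (C n) (1 / Suc n)\<close>.
\<close>

lemma ex_stays:
  obtains C :: "nat \<Rightarrow> (real ^ 'n) set"
  where "\<And>n. compact (C n)" "\<And>n. C n \<subseteq> \<Omega>"
    "\<And>x a b. (\<And>s. s \<in> {a..b} \<Longrightarrow> \<Phi> x s \<in> \<Omega>) \<Longrightarrow>
       \<exists>N. \<forall>n\<ge>N. \<forall>q\<ge>a. q + 1 / real (Suc n) \<le> b \<longrightarrow> \<Phi> x q \<in> stays (C n) (1 / real (Suc n))"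
proof -
  obtain C :: "nat \<Rightarrow> (real ^ 'n) set"
    where C: "\<And>n. compact (C n)" "\<And>n. C n \<subseteq> \<Omega>"
      and exhaust: "\<And>K. compact K \<Longrightarrow> K \<subseteq> \<Omega> \<Longrightarrow> \<exists>N. \<forall>n\<ge>N. K \<subseteq> C n"
    using open_Union_compact_subsets[OF open_domain] by metis
  have "\<exists>N. \<forall>n\<ge>N. \<forall>q\<ge>a. q + 1 / real (Suc n) \<le> b \<longrightarrow> \<Phi> x q \<in> stays (C n) (1 / real (Suc n))"
    if in_domain: "\<And>s. s \<in> {a..b} \<Longrightarrow> \<Phi> x s \<in> \<Omega>" for x a b
  proof -
    have "compact (\<Phi> x ` {a..b})"
      by (intro compact_continuous_image continuous_intros compact_Icc)
    then obtain N where "\<And>n. n \<ge> N \<Longrightarrow> \<Phi> x ` {a..b} \<subseteq> C n"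
      using exhaust[of "\<Phi> x ` {a..b}"] in_domain by (metis image_subsetI)
    then have "\<And>n s. n \<ge> N \<Longrightarrow> a \<le> s \<Longrightarrow> s \<le> b \<Longrightarrow> \<Phi> x s \<in> C n"
      by (meson atLeastAtMost_iff image_subset_iff)
    then show ?thesis
      by (intro exI[of _ N]) (auto simp: stays_def)
  qed
  with C show thesis
    by (rule that)
qed

lemma remains_in_domain:
  assumes "\<Phi> x t \<in> \<Omega>"
  obtains d where "d > 0" "\<And>s. \<bar>s - t\<bar> \<le> d \<Longrightarrow> \<Phi> x s \<in> \<Omega>"
proof -
  have "open (\<Phi> x -` \<Omega>)"
    by (intro open_vimage open_domain continuous_intros)
  then obtain d where "d > 0" "cball t d \<subseteq> \<Phi> x -` \<Omega>"
    using assms open_contains_cball by (metis vimageI)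
  then show thesis
    by (intro that[of d]) (auto simp: subset_iff dist_real_def abs_minus_commute)
qed

text \<open>
  The increments of \<open>f\<close> determine the integrals of \<open>g\<close> over short times, and these determine \<open>g\<close> by
  differentiation.
\<close>

lemma weak_eq_unique:
  assumes "weak_eq f g1" "weak_eq f g2"
  shows "AE x in \<nu>. x \<in> \<Omega> \<longrightarrow> g1 x = g2 x"
proof -
  obtain C :: "nat \<Rightarrow> (real ^ 'n) set"
    where C: "\<And>n. compact (C n)" "\<And>n. C n \<subseteq> \<Omega>"
    and stays: "\<And>x a b. (\<And>s. s \<in> {a..b} \<Longrightarrow> \<Phi> x s \<in> \<Omega>) \<Longrightarrow>
       \<exists>N. \<forall>n\<ge>N. \<forall>q\<ge>a. q + 1 / real (Suc n) \<le> b \<longrightarrow> \<Phi> x q \<in> stays (C n) (1 / real (Suc n))"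
    by (rule ex_stays) blast
  have increment: "AE x in \<nu>. \<forall>n m. m > n \<longrightarrow> x \<in> stays (C n) (1 / real (Suc n)) \<longrightarrow>
      f x - f (\<Phi> x (1 / real (Suc m))) = fwd (1 / real (Suc m)) g x"
    if "weak_eq f g" for g
    unfolding AE_all_countable
  proof (intro allI)
    fix n m :: nat
    show "AE x in \<nu>. m > n \<longrightarrow> x \<in> stays (C n) (1 / real (Suc n)) \<longrightarrow>
        f x - f (\<Phi> x (1 / real (Suc m))) = fwd (1 / real (Suc m)) g x"
      using weak_eq_imp_increment[OF that C(1,2), of "1 / real (Suc m)" "1 / real (Suc n)" n]
      by (cases "m > n") (auto simp: field_simps)
  qed
  have "integrable \<nu> g1" "integrable \<nu> g2"
    using assms by (auto simp: weak_eq_def)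
  from AE_fwd_differentiation[OF this(1)] AE_fwd_differentiation[OF this(2)]
    increment[OF assms(1)] increment[OF assms(2)]
  show ?thesis
  proof eventually_elim
    case (elim x)
    show ?case
    proof
      assume "x \<in> \<Omega>"
      then obtain d where d: "d > 0" "\<And>s. \<bar>s - 0\<bar> \<le> d \<Longrightarrow> \<Phi> x s \<in> \<Omega>"
        using remains_in_domain[of x 0] by auto
      obtain m0 where m0: "1 / real (Suc m0) < d"
        using \<open>d > 0\<close> nat_approx_posE by blast
      obtain N where N: "\<And>n q. n \<ge> N \<Longrightarrow> q \<ge> 0 \<Longrightarrow> q + 1 / real (Suc n) \<le> d \<Longrightarrow>
          \<Phi> x q \<in> stays (C n) (1 / real (Suc n))"
        using stays[of 0 d x] d(2) by auto
      define n where "n = max N m0"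
      have "1 / real (Suc n) \<le> 1 / real (Suc m0)"
        by (simp add: n_def field_simps)
      then have n: "x \<in> stays (C n) (1 / real (Suc n))"
        using N[of n 0] m0 by (simp add: n_def)
      have "\<forall>\<^sub>F m in sequentially. real (Suc m) * fwd (1 / real (Suc m)) g1 x = real (Suc m) * fwd (1 / real (Suc m)) g2 x"
        using eventually_gt_at_top[of n] by eventually_elim (use elim(3,4) n in metis)
      from tendsto_cong[OF this] elim(1) have "(\<lambda>m. real (Suc m) * fwd (1 / real (Suc m)) g2 x) \<longlonglongrightarrow> g1 x"
        by simp
      then show "g1 x = g2 x"
        using elim(2) LIMSEQ_unique by blast
    qed
  qed
qed

end

section \<open>The representative with increments at all times\<close>

lemma average_tendsto:
  fixes c :: "real \<Rightarrow> real"
  assumes c: "continuous_on {t..b} c" and "t < b"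
  shows "(\<lambda>m. real (Suc m) * integral {t..t + 1 / real (Suc m)} c) \<longlonglongrightarrow> c t"
proof -
  let ?u = "\<lambda>m. t + 1 / real (Suc m)"
  have "((\<lambda>u. integral {t..u} c) has_real_derivative c t) (at t within {t..b})"
    using \<open>t < b\<close> by (intro integral_has_real_derivative c) auto
  then have lim: "((\<lambda>u. (integral {t..u} c - integral {t..t} c) / (u - t)) \<longlongrightarrow> c t) (at t within {t..b})"
    by (simp add: has_field_derivative_iff)
  have "?u \<longlonglongrightarrow> t"
    using LIMSEQ_inverse_real_of_nat_add[of t] by (simp add: inverse_eq_divide)
  then have "filterlim ?u (at t within {t..b}) sequentially"
    unfolding filterlim_at using order_tendstoD(2)[of ?u t sequentially b] \<open>t < b\<close>
    by (auto elim!: eventually_mono)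
  from filterlim_compose[OF lim this] show ?thesis
    by (simp add: mult.commute)
qed

context transport_domain
begin

text \<open>
  The increment formula holds for each fixed time increment outside a null set that depends on the
  increment, so it may fail for \<open>f\<close> at some times on every trajectory. The limit of the forward
  averages depends only on the values of \<open>f\<close> at almost every time, and it is the value of the
  continuous version of \<open>f\<close> along the trajectory.
\<close>

definition rep :: "(real ^ 'n \<Rightarrow> real) \<Rightarrow> real ^ 'n \<Rightarrow> real" where
  "rep f x = lim (\<lambda>m. real (Suc m) * fwd (1 / real (Suc m)) f x)"

lemma AE_rep_eq:
  assumes "integrable \<nu> f"
  shows "AE x in \<nu>. rep f x = f x"
  using AE_fwd_differentiation[OF assms] by eventually_elim (simp add: rep_def limI)

text \<open>
  By Fubini, for almost every starting point the increment formula holds at almost every time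
  increment. Hence \<open>f\<close> agrees along the trajectory with a continuous function \<open>c\<close> at almost every
  time, and the averages that define \<open>rep f\<close> are averages of \<open>c\<close>.
\<close>

lemma weak_eq_imp_rep_increment:
  assumes weak: "weak_eq f g" and C: "compact C" "C \<subseteq> \<Omega>"
  shows "AE x in \<nu>. x \<in> stays C e \<longrightarrow>
    (\<forall>t. 0 \<le> t \<and> t < e \<longrightarrow> rep f (\<Phi> x t) = f x - integral {0..t} (\<lambda>s. g (\<Phi> x s)))"
proof -
  have f: "integrable \<nu> f" and g: "integrable \<nu> g"
    using weak by (auto simp: weak_eq_def)
  have [measurable]: "f \<in> borel_measurable borel" "g \<in> borel_measurable borel"
    using borel_measurable_integrable[OF f] borel_measurable_integrable[OF g] by simp_all
  have [measurable]: "stays C e \<in> sets borel"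
    using closed_stays[OF compact_imp_closed[OF C(1)]] by simp
  have "AE k in lborel. AE x in \<nu>. 0 \<le> k \<longrightarrow> k < e \<longrightarrow> x \<in> stays C e \<longrightarrow> f x - f (\<Phi> x k) = fwd k g x"
  proof (rule AE_I2)
    fix k
    show "AE x in \<nu>. 0 \<le> k \<longrightarrow> k < e \<longrightarrow> x \<in> stays C e \<longrightarrow> f x - f (\<Phi> x k) = fwd k g x"
      using weak_eq_imp_increment[OF weak C, of k e] by (cases "0 \<le> k \<and> k < e") auto
  qed
  then have "AE x in \<nu>. AE k in lborel. 0 \<le> k \<longrightarrow> k < e \<longrightarrow> x \<in> stays C e \<longrightarrow> f x - f (\<Phi> x k) = fwd k g x"
    by (rule AE_commute[THEN iffD1, rotated]) measurable
  with AE_integrable_along_flow[OF f] AE_integrable_along_flow[OF g]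
  show ?thesis
  proof eventually_elim
    case (elim x)
    let ?f = "\<lambda>s. f (\<Phi> x s)" and ?g = "\<lambda>s. g (\<Phi> x s)"
    note f_int = elim(1)[rule_format] and g_int = elim(2)[rule_format]
    define c where "c t = f x - integral {0..t} ?g" for t
    have c: "continuous_on {0..b} c" for b
      unfolding c_def
      by (intro continuous_intros indefinite_integral_continuous_1 set_borel_integral_eq_integral(1) g_int)
    show ?case
    proof (intro impI allI, elim conjE)
      fix t assume x: "x \<in> stays C e" and t: "0 \<le> t" "t < e"
      have fwd_g: "fwd k g x = integral {0..k} ?g" for k
        using fwd_eq_integral[of 0 k g x] g_int by simp
      have "AE k in lborel. k \<in> {0..<e} \<longrightarrow> ?f k = c k"
        using elim(3) by eventually_elim (use x fwd_g in \<open>auto simp: c_def\<close>)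
      then have "AE k in lebesgue. k \<in> {0..<e} \<longrightarrow> ?f k = c k"
        by (simp add: AE_completion_iff)
      then obtain N where N: "negligible N" "\<And>k. k \<in> {0..<e} \<Longrightarrow> k \<notin> N \<Longrightarrow> ?f k = c k"
        unfolding negligible_iff_null_sets by (auto elim!: AE_E3)
      have average: "fwd h f (\<Phi> x t) = integral {t..t + h} c" if "t + h < e" for h
      proof -
        have "fwd h f (\<Phi> x t) = integral {t..t + h} ?f"
          by (rule fwd_eq_integral[OF f_int])
        also have "\<dots> = integral {t..t + h} c"
          by (rule integral_spike[OF N(1)]) (use N(2) that t in auto)
        finally show ?thesis .
      qed
      obtain m0 where m0: "1 / real (Suc m0) < e - t"
        using t nat_approx_posE[of "e - t"] by auto
      have "\<forall>\<^sub>F m in sequentially.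
          real (Suc m) * integral {t..t + 1 / real (Suc m)} c = real (Suc m) * fwd (1 / real (Suc m)) f (\<Phi> x t)"
        using eventually_ge_at_top[of m0]
      proof eventually_elim
        case (elim m)
        have "1 / real (Suc m) \<le> 1 / real (Suc m0)"
          using elim by (simp add: field_simps)
        then show ?case using m0 by (simp add: average)
      qed
      moreover have "(\<lambda>m. real (Suc m) * integral {t..t + 1 / real (Suc m)} c) \<longlonglongrightarrow> c t"
        by (rule average_tendsto[OF continuous_on_subset[OF c[of e]]]) (use t in auto)
      ultimately have "(\<lambda>m. real (Suc m) * fwd (1 / real (Suc m)) f (\<Phi> x t)) \<longlonglongrightarrow> c t"
        by (rule Lim_transform_eventually[rotated])
      then show "rep f (\<Phi> x t) = f x - integral {0..t} ?g"
        unfolding rep_def c_def by (rule limI)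
    qed
  qed
qed

text \<open>
  The local formula extends to all of a piece of a trajectory inside \<open>\<Omega>\<close>, since increments and
  integrals are both additive. Only rational starting times are used, so that one null set of
  starting points is excluded for all of them.
\<close>

lemma weak_eq_imp_rep_increments:
  assumes weak: "weak_eq f g"
  shows "AE x in \<nu>. \<forall>a b. a \<le> b \<and> (\<forall>s\<in>{a..b}. \<Phi> x s \<in> \<Omega>) \<longrightarrow>
    rep f (\<Phi> x a) - rep f (\<Phi> x b) = integral {a..b} (\<lambda>s. g (\<Phi> x s))"
proof -
  have g: "integrable \<nu> g"
    using weak by (auto simp: weak_eq_def)
  obtain C :: "nat \<Rightarrow> (real ^ 'n) set"
    where C: "\<And>n. compact (C n)" "\<And>n. C n \<subseteq> \<Omega>"
    and stays: "\<And>x a b. (\<And>s. s \<in> {a..b} \<Longrightarrow> \<Phi> x s \<in> \<Omega>) \<Longrightarrow>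
       \<exists>N. \<forall>n\<ge>N. \<forall>q\<ge>a. q + 1 / real (Suc n) \<le> b \<longrightarrow> \<Phi> x q \<in> stays (C n) (1 / real (Suc n))"
    by (rule ex_stays) blast
  have "AE x in \<nu>. \<forall>n. x \<in> stays (C n) (1 / real (Suc n)) \<longrightarrow>
      (\<forall>t. 0 \<le> t \<and> t < 1 / real (Suc n) \<longrightarrow> rep f (\<Phi> x t) = f x - integral {0..t} (\<lambda>s. g (\<Phi> x s)))"
    using weak_eq_imp_rep_increment[OF weak C] by (simp add: AE_all_countable)
  from AE_rational_times[OF this] AE_integrable_along_flow[OF g]
  show ?thesis
  proof eventually_elim
    case (elim x)
    let ?g = "\<lambda>s. g (\<Phi> x s)"
    have g_int: "?g integrable_on {a..b}" for a b
      using elim(2) set_borel_integral_eq_integral(1) by blast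
    have from_rational: "rep f (\<Phi> x t) = f (\<Phi> x q) - integral {q..t} ?g"
      if q: "q \<in> \<rat>" "\<Phi> x q \<in> stays (C n) (1 / real (Suc n))" and t: "q \<le> t" "t < q + 1 / real (Suc n)" for q n t
    proof -
      have "rep f (\<Phi> x t) = f (\<Phi> x q) - integral {0..t - q} (\<lambda>s. g (\<Phi> x (q + s)))"
        using elim(1)[rule_format, OF q, of "t - q"] t by simp
      also have "integral {0..t - q} (\<lambda>s. g (\<Phi> x (q + s))) = integral {q..t} ?g"
        using integral_shift_Icc_real[of 0 "t - q" ?g q] by (simp add: o_def)
      finally show ?thesis .
    qed
    show ?case
    proof (intro allI impI, elim conjE)
      fix a b :: real assume "a \<le> b" and in_domain: "\<forall>s\<in>{a..b}. \<Phi> x s \<in> \<Omega>"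
      from \<open>a \<le> b\<close> show "rep f (\<Phi> x a) - rep f (\<Phi> x b) = integral {a..b} ?g"
      proof (induction a b rule: Bolzano)
        case (trans a b c)
        then show ?case
          using Henstock_Kurzweil_Integration.integral_combine[of a b c ?g] g_int by simp
      next
        case (local t)
        then obtain d where d: "d > 0" "\<And>s. \<bar>s - t\<bar> \<le> d \<Longrightarrow> \<Phi> x s \<in> \<Omega>"
          using remains_in_domain[of x t] in_domain by auto
        obtain N where N: "\<And>n q. n \<ge> N \<Longrightarrow> q \<ge> t - d \<Longrightarrow> q + 1 / real (Suc n) \<le> t + d \<Longrightarrow>
            \<Phi> x q \<in> stays (C n) (1 / real (Suc n))"
          using stays[of "t - d" "t + d" x] d(2) by (force simp: abs_le_iff)
        obtain m0 where m0: "1 / real (Suc m0) < d"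
          using \<open>d > 0\<close> nat_approx_posE by blast
        define n where "n = max N m0"
        define e where "e = 1 / real (Suc n)"
        have "e \<le> 1 / real (Suc m0)" "e > 0"
          by (simp_all add: e_def n_def field_simps)
        \<comment> \<open>A rational time so shortly before \<open>t\<close> that the interval \<open>{q..<q + e}\<close> contains a neighbourhood of \<open>t\<close>.\<close>
        then obtain q where q: "q \<in> \<rat>" "t - e < q" "q < t"
          using Rats_dense_in_real[of "t - e" t] by auto
        have "n \<ge> N" "t - d \<le> q" "q + e \<le> t + d"
          using q m0 \<open>e \<le> _\<close> by (simp_all add: n_def)
        then have q_stays: "\<Phi> x q \<in> stays (C n) (1 / real (Suc n))"
          unfolding e_def by (rule N)
        have "rep f (\<Phi> x a) - rep f (\<Phi> x b) = integral {a..b} ?g"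
          if "a \<le> t" "t \<le> b" "b - a < min (t - q) (q + e - t)" for a b
        proof -
          have "q \<le> a" "a \<le> b" "b < q + e" "a < q + e"
            using that by auto
          then show ?thesis
            using from_rational[OF q(1) q_stays, of a] from_rational[OF q(1) q_stays, of b]
              Henstock_Kurzweil_Integration.integral_combine[of q a b ?g] g_int
            by (simp add: e_def)
        qed
        then show ?case
          using q by (intro exI[of _ "min (t - q) (q + e - t)"]) auto
      qed
    qed
  qed
qed

end

section \<open>Integration by parts along trajectories\<close>

text \<open>
  Here \<open>u\<close> is an indefinite integral of the merely integrable function \<open>- \<gamma>\<close>, so the fundamental
  theorem of calculus does not apply to \<open>u * v\<close>. On short intervals the defect \<open>E\<close> of the formula is
  at most \<open>\<epsilon>\<close> times the integral of \<open>\<bar>v'\<bar> + \<bar>\<gamma>\<bar>\<close>, by the continuity of \<open>u\<close> and \<open>v\<close>. Both are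
  additive in the interval, so the bound holds on all of \<open>{a..b}\<close>, for every \<open>\<epsilon>\<close>.
\<close>

lemma has_integral_product_rule:
  fixes u v v' \<gamma> :: "real \<Rightarrow> real"
  assumes "a \<le> b" and \<gamma>: "set_integrable lebesgue {a..b} \<gamma>"
    and u: "\<And>s t. a \<le> s \<Longrightarrow> s \<le> t \<Longrightarrow> t \<le> b \<Longrightarrow> u s - u t = integral {s..t} \<gamma>"
    and v: "\<And>t. t \<in> {a..b} \<Longrightarrow> (v has_real_derivative v' t) (at t)"
    and v': "continuous_on {a..b} v'"
  shows "((\<lambda>s. u s * v' s - \<gamma> s * v s) has_integral u b * v b - u a * v a) {a..b}"
proof -
  have \<gamma>_int: "\<gamma> absolutely_integrable_on {s..t}" if "a \<le> s" "t \<le> b" for s t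
    by (rule set_integrable_subset[OF \<gamma>]) (use that in auto)
  note \<gamma>_int' = set_lebesgue_integral_eq_integral(1)[OF \<gamma>_int]
  have v_cont: "continuous_on {a..b} v"
    by (auto intro!: continuous_at_imp_continuous_on DERIV_isCont[OF v])
  have u_cont: "continuous_on {a..b} u"
  proof -
    have "continuous_on {a..b} (\<lambda>t. u a - integral {a..t} \<gamma>)"
      by (intro continuous_intros indefinite_integral_continuous_1 \<gamma>_int') auto
    then show ?thesis
      by (rule continuous_on_eq) (use u[of a] in force)
  qed
  have \<gamma>_times: "(\<lambda>s. \<gamma> s * w s) integrable_on {s..t}"
    if "a \<le> s" "t \<le> b" and w: "continuous_on {a..b} w" for s t and w :: "real \<Rightarrow> real"
  proof -
    have w': "continuous_on {s..t} w"
      using that by (auto intro: continuous_on_subset[OF w])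
    have "(\<lambda>s. w s * \<gamma> s) absolutely_integrable_on {s..t}"
      by (rule absolutely_integrable_bounded_measurable_product_real)
         (use that w' \<gamma>_int in \<open>auto intro!: continuous_imp_measurable_on_sets_lebesgue
            compact_imp_bounded compact_continuous_image\<close>)
    then show ?thesis
      using set_lebesgue_integral_eq_integral(1) by (simp add: mult.commute)
  qed
  have cont_int: "w integrable_on {s..t}" if "a \<le> s" "t \<le> b" "continuous_on {a..b} w" for s t and w :: "real \<Rightarrow> real"
    by (intro integrable_continuous_interval continuous_on_subset[OF that(3)]) (use that in auto)
  define p where "p s = u s * v' s - \<gamma> s * v s" for s
  have p_int: "p integrable_on {s..t}" if "a \<le> s" "t \<le> b" for s t
    unfolding p_def
    by (intro Henstock_Kurzweil_Integration.integrable_diff cont_int \<gamma>_times that continuous_on_mult u_cont v_cont v')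
  define M where "M s = \<bar>v' s\<bar> + \<bar>\<gamma> s\<bar>" for s
  have M_int: "M integrable_on {s..t}" if "a \<le> s" "t \<le> b" for s t
    unfolding M_def
  proof (rule Henstock_Kurzweil_Integration.integrable_add)
    show "(\<lambda>r. \<bar>v' r\<bar>) integrable_on {s..t}"
      by (intro cont_int that continuous_intros v')
    show "(\<lambda>r. \<bar>\<gamma> r\<bar>) integrable_on {s..t}"
      using \<gamma>_int[OF that] by (simp add: absolutely_integrable_on_def)
  qed
  define E where "E s t = integral {s..t} p - (u t * v t - u s * v s)" for s t
  have small: "\<bar>E a b\<bar> \<le> \<epsilon> * integral {a..b} M" if "\<epsilon> > 0" for \<epsilon>
  proof -
    have "a \<le> a \<longrightarrow> b \<le> b \<longrightarrow> \<bar>E a b\<bar> \<le> \<epsilon> * integral {a..b} M"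
      using \<open>a \<le> b\<close>
    proof (induction rule: Bolzano[where P = "\<lambda>s t. a \<le> s \<longrightarrow> t \<le> b \<longrightarrow> \<bar>E s t\<bar> \<le> \<epsilon> * integral {s..t} M"])
      case (trans r s t)
      show ?case
      proof (intro impI)
        assume rt: "a \<le> r" "t \<le> b"
        have "E r t = E r s + E s t" "integral {r..t} M = integral {r..s} M + integral {s..t} M"
          using Henstock_Kurzweil_Integration.integral_combine[OF trans(3,4) p_int[OF rt]]
            Henstock_Kurzweil_Integration.integral_combine[OF trans(3,4) M_int[OF rt]]
          by (simp_all add: E_def)
        moreover have "\<bar>E r s\<bar> \<le> \<epsilon> * integral {r..s} M" "\<bar>E s t\<bar> \<le> \<epsilon> * integral {s..t} M"
          using trans rt by auto
        ultimately show "\<bar>E r t\<bar> \<le> \<epsilon> * integral {r..t} M"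
          by (simp add: distrib_left)
      qed
    next
      case (local x)
      then have x: "x \<in> {a..b}" by simp
      from u_cont x \<open>\<epsilon> > 0\<close> obtain d1 where d1: "d1 > 0" "\<And>s. s \<in> {a..b} \<Longrightarrow> \<bar>s - x\<bar> < d1 \<Longrightarrow> \<bar>u s - u x\<bar> < \<epsilon> / 2"
        unfolding continuous_on_iff dist_real_def by (meson half_gt_zero)
      from v_cont x \<open>\<epsilon> > 0\<close> obtain d2 where d2: "d2 > 0" "\<And>s. s \<in> {a..b} \<Longrightarrow> \<bar>s - x\<bar> < d2 \<Longrightarrow> \<bar>v s - v x\<bar> < \<epsilon> / 2"
        unfolding continuous_on_iff dist_real_def by (meson half_gt_zero)
      have "\<bar>E s t\<bar> \<le> \<epsilon> * integral {s..t} M"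
        if st: "s \<le> x" "x \<le> t" "t - s < min d1 d2" "a \<le> s" "t \<le> b" for s t
      proof -
        have near: "\<bar>u r - u x\<bar> < \<epsilon> / 2" "\<bar>v r - v x\<bar> < \<epsilon> / 2" if "r \<in> {s..t}" for r
          using d1(2)[of r] d2(2)[of r] that st by (auto simp: abs_less_iff)
        have close: "\<bar>u r - u t\<bar> \<le> \<epsilon>" "\<bar>v r - v s\<bar> \<le> \<epsilon>" if "r \<in> {s..t}" for r
        proof -
          have "s \<in> {s..t}" "t \<in> {s..t}"
            using st by auto
          from near[OF this(1)] near[OF this(2)] near[OF that]
          show "\<bar>u r - u t\<bar> \<le> \<epsilon>" "\<bar>v r - v s\<bar> \<le> \<epsilon>" by linarith+
        qed
        have v_diff: "(v' has_integral v t - v s) {s..t}"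
        proof (rule fundamental_theorem_of_calculus)
          fix r assume "r \<in> {s..t}"
          then have "(v has_vector_derivative v' r) (at r)"
            using v[of r] st by (simp add: has_real_derivative_iff_has_vector_derivative)
          then show "(v has_vector_derivative v' r) (at r within {s..t})"
            by (rule has_vector_derivative_at_within)
        qed (use st in auto)
        have u_diff: "(\<gamma> has_integral u s - u t) {s..t}"
          using u[of s t] \<gamma>_int'[of s t] st by (simp add: has_integral_integral)
        have "((\<lambda>r. u t * v' r - \<gamma> r * v s) has_integral u t * (v t - v s) - (u s - u t) * v s) {s..t}"
          by (intro has_integral_diff has_integral_mult_right has_integral_mult_left v_diff u_diff)
        from has_integral_diff[OF integrable_integral[OF p_int] this] st
        have E: "((\<lambda>r. (u r - u t) * v' r - \<gamma> r * (v r - v s)) has_integral E s t) {s..t}"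
          by (simp add: p_def E_def algebra_simps)
        have "norm (integral {s..t} (\<lambda>r. (u r - u t) * v' r - \<gamma> r * (v r - v s))) \<le> integral {s..t} (\<lambda>r. \<epsilon> * M r)"
        proof (rule integral_norm_bound_integral)
          fix r assume r: "r \<in> {s..t}"
          have "\<bar>(u r - u t) * v' r - \<gamma> r * (v r - v s)\<bar> \<le> \<bar>u r - u t\<bar> * \<bar>v' r\<bar> + \<bar>v r - v s\<bar> * \<bar>\<gamma> r\<bar>"
            by (rule order_trans[OF abs_triangle_ineq4]) (simp add: abs_mult)
          also have "\<dots> \<le> \<epsilon> * \<bar>v' r\<bar> + \<epsilon> * \<bar>\<gamma> r\<bar>"
            by (intro add_mono mult_right_mono close[OF r] abs_ge_zero)
          finally show "norm ((u r - u t) * v' r - \<gamma> r * (v r - v s)) \<le> \<epsilon> * M r"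
            by (simp add: M_def distrib_left)
        qed (use E M_int[of s t] st in \<open>auto intro!: integrable_on_mult_right\<close>)
        then show ?thesis
          using E by (simp add: integral_unique)
      qed
      then show ?case
        using d1(1) d2(1) by (intro exI[of _ "min d1 d2"]) auto
    qed
    then show ?thesis by simp
  qed
  have "\<bar>E a b\<bar> \<le> 0"
  proof (rule field_le_epsilon)
    fix e :: real assume "e > 0"
    have "integral {a..b} M \<ge> 0"
      by (rule Henstock_Kurzweil_Integration.integral_nonneg[OF M_int]) (auto simp: M_def)
    then have "e / (integral {a..b} M + 1) * integral {a..b} M \<le> e" "e / (integral {a..b} M + 1) > 0"
      using \<open>e > 0\<close> by (auto simp: field_simps)
    then show "\<bar>E a b\<bar> \<le> 0 + e"
      using small by fastforce
  qed
  then have "integral {a..b} p = u b * v b - u a * v a"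
    by (simp add: E_def)
  then show ?thesis
    using integrable_integral[OF p_int[of a b]] by (simp add: p_def[abs_def])
qed

context transport_domain
begin

lemma within_exit_times:
  assumes "\<And>s. a < s \<Longrightarrow> s < b \<Longrightarrow> \<Phi> x s \<in> \<Omega>" and "a < 0" "0 < b"
  shows "- tau_minus \<Phi> \<Omega> x \<le> ereal a" "ereal b \<le> tau_plus \<Phi> \<Omega> x"
proof -
  have "ereal (- a) \<le> tau_minus \<Phi> \<Omega> x"
    unfolding tau_minus_def
  proof (rule Inf_greatest, clarsimp)
    fix s assume "0 < s" "\<Phi> x (- s) \<notin> \<Omega>"
    then show "- a \<le> s"
      using assms(1)[of "- s"] assms(3) by linarith
  qed
  then show "- tau_minus \<Phi> \<Omega> x \<le> ereal a"
    by (simp add: ereal_uminus_le_reorder)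
  show "ereal b \<le> tau_plus \<Phi> \<Omega> x"
    unfolding tau_plus_def
  proof (rule Inf_greatest, clarsimp)
    fix s assume "0 < s" "\<Phi> x s \<notin> \<Omega>"
    then show "b \<le> s"
      using assms(1)[of s] assms(2) by linarith
  qed
qed

text \<open>
  The definition of a test function refers to trajectories starting at time \<open>0\<close>; a shift of time
  by some \<open>r\<close> between \<open>a\<close> and \<open>b\<close> gives the statement on the piece of the trajectory between these
  times, even if \<open>x \<notin> \<Omega>\<close>.
\<close>

lemma test_function_along_trajectory:
  assumes \<psi>: "\<psi> \<in> test_functions \<mu> \<Phi> \<Omega>" and dom: "\<And>s. a < s \<Longrightarrow> s < b \<Longrightarrow> \<Phi> x s \<in> \<Omega>"
  shows "a < t \<Longrightarrow> t < b \<Longrightarrow> ((\<lambda>s. \<psi> (\<Phi> x s)) has_real_derivative flow_deriv \<Phi> \<psi> (\<Phi> x t)) (at t)"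
    and "continuous_on {a<..<b} (\<lambda>t. flow_deriv \<Phi> \<psi> (\<Phi> x t))"
proof -
  have *: "(\<forall>t\<in>{a<..<b}. ((\<lambda>s. \<psi> (\<Phi> x s)) has_real_derivative flow_deriv \<Phi> \<psi> (\<Phi> x t)) (at t)) \<and>
    continuous_on {a<..<b} (\<lambda>t. flow_deriv \<Phi> \<psi> (\<Phi> x t))"
  proof (cases "a < b")
    case True
    then obtain r where r: "a < r" "r < b" using dense by blast
    let ?y = "\<Phi> x r"
    let ?J = "einterval (- tau_minus \<Phi> \<Omega> ?y) (tau_plus \<Phi> \<Omega> ?y)"
    have "?y \<in> \<Omega>" using dom r by simp
    then have "(\<lambda>s. \<psi> (\<Phi> ?y s)) C1_differentiable_on ?J"
      using \<psi> unfolding test_functions_def by blast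
    then obtain D where D: "\<And>s. s \<in> ?J \<Longrightarrow> ((\<lambda>s. \<psi> (\<Phi> ?y s)) has_vector_derivative D s) (at s)"
      and D_cont: "continuous_on ?J D"
      unfolding C1_differentiable_on_def by blast
    have "- tau_minus \<Phi> \<Omega> ?y \<le> ereal (a - r)" "ereal (b - r) \<le> tau_plus \<Phi> \<Omega> ?y"
      using within_exit_times[of "a - r" "b - r" ?y] dom r by auto
    then have J: "t - r \<in> ?J" if "a < t" "t < b" for t
      using that unfolding einterval_def
      by (auto intro: le_less_trans[of _ "ereal (a - r)"] less_le_trans[of _ "ereal (b - r)"])
    have deriv: "((\<lambda>s. \<psi> (\<Phi> x s)) has_real_derivative D (t - r)) (at t)" if "a < t" "t < b" for t
    proof -
      have "((\<lambda>s. \<psi> (\<Phi> x (r + s))) has_real_derivative D (t - r)) (at (t - r))"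
        using D[OF J[OF that]] by (simp add: has_real_derivative_iff_has_vector_derivative)
      then show ?thesis
        using DERIV_shift[of "\<lambda>s. \<psi> (\<Phi> x s)" "D (t - r)" "t - r" r] by (simp add: add.commute)
    qed
    have flow_deriv: "flow_deriv \<Phi> \<psi> (\<Phi> x t) = D (t - r)" if "a < t" "t < b" for t
    proof -
      have "((\<lambda>s. \<psi> (\<Phi> x (t + s))) has_real_derivative D (t - r)) (at 0)"
        using DERIV_shift[of "\<lambda>s. \<psi> (\<Phi> x s)" "D (t - r)" 0 t] deriv[OF that] by (simp add: add.commute)
      then show ?thesis
        by (simp add: flow_deriv_def DERIV_imp_deriv)
    qed
    have "continuous_on {a<..<b} (\<lambda>t. D (t - r))"
      by (rule continuous_on_compose2[OF D_cont]) (auto intro!: continuous_intros J)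
    then have "continuous_on {a<..<b} (\<lambda>t. flow_deriv \<Phi> \<psi> (\<Phi> x t))"
      by (rule continuous_on_eq) (simp add: flow_deriv)
    then show ?thesis
      using deriv flow_deriv by simp
  qed auto
  then show "a < t \<Longrightarrow> t < b \<Longrightarrow> ((\<lambda>s. \<psi> (\<Phi> x s)) has_real_derivative flow_deriv \<Phi> \<psi> (\<Phi> x t)) (at t)"
    by simp
  from * show "continuous_on {a<..<b} (\<lambda>t. flow_deriv \<Phi> \<psi> (\<Phi> x t))"
    by simp
qed

text \<open>
  By the Lindelof property, countably many of the open sets in the definition of the support cover
  its complement.
\<close>

lemma AE_zero_off_support: "AE x in \<nu>. x \<in> \<Omega> \<longrightarrow> x \<notin> ae_support \<mu> \<Omega> \<psi> \<longrightarrow> \<psi> x = 0"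
proof -
  let ?\<U> = "{U. open U \<and> U \<subseteq> \<Omega> \<and> (AE x\<in>U in \<mu>. \<psi> x = 0)}"
  obtain \<V> where \<V>: "\<V> \<subseteq> ?\<U>" "countable \<V>" "\<Union>\<V> = \<Union>?\<U>"
    using Lindelof_openin[of ?\<U> UNIV] by auto
  have "AE x in \<nu>. \<forall>U\<in>\<V>. x \<in> U \<longrightarrow> \<psi> x = 0"
    using \<V>(1) by (subst AE_ball_countable[OF \<V>(2)]) (auto simp: AE_iff)
  then show ?thesis
  proof eventually_elim
    case (elim x)
    then show ?case
      unfolding ae_support_def \<V>(3)[symmetric] by blast
  qed
qed

text \<open>
  On a trajectory, a test function that vanishes off \<open>K\<close> at all rational times vanishes off \<open>K\<close>
  at all times, by continuity.
\<close>

lemma zero_off_support_along_trajectory: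
  assumes \<psi>: "\<psi> \<in> test_functions \<mu> \<Phi> \<Omega>" and K: "closed K"
    and rat: "\<And>q. q \<in> \<rat> \<Longrightarrow> \<Phi> x q \<in> \<Omega> \<Longrightarrow> \<Phi> x q \<notin> K \<Longrightarrow> \<psi> (\<Phi> x q) = 0"
    and t: "\<Phi> x t \<in> \<Omega>" "\<Phi> x t \<notin> K"
  shows "\<psi> (\<Phi> x t) = 0" "flow_deriv \<Phi> \<psi> (\<Phi> x t) = 0"
proof -
  have "open (\<Phi> x -` (\<Omega> - K))"
    by (intro open_vimage open_Diff open_domain K continuous_intros)
  then obtain d where d: "d > 0" "\<And>s. \<bar>s - t\<bar> < d \<Longrightarrow> \<Phi> x s \<in> \<Omega> - K"
    using t unfolding open_dist dist_real_def by (metis DiffI vimageE vimageI)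
  have deriv: "((\<lambda>s. \<psi> (\<Phi> x s)) has_real_derivative flow_deriv \<Phi> \<psi> (\<Phi> x s)) (at s)" if "\<bar>s - t\<bar> < d" for s
    by (rule test_function_along_trajectory(1)[OF \<psi>, of "t - d" "t + d"]) (use d that in auto)
  have zero: "\<psi> (\<Phi> x s) = 0" if s: "\<bar>s - t\<bar> < d" for s
  proof (rule ccontr)
    assume "\<psi> (\<Phi> x s) \<noteq> 0"
    with continuous_at_avoid[OF DERIV_isCont[OF deriv[OF s]], of 0]
    obtain e where e: "e > 0" "\<And>r. \<bar>r - s\<bar> < e \<Longrightarrow> \<psi> (\<Phi> x r) \<noteq> 0"
      by (auto simp: dist_real_def abs_minus_commute)
    have "s < min (s + e) (t + d)"
      using s e(1) by auto
    then obtain q where "q \<in> \<rat>" "s < q" "q < min (s + e) (t + d)"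
      using Rats_dense_in_real by blast
    then show False
      using e(2)[of q] rat[of q] d(2)[of q] s by (auto simp: abs_less_iff)
  qed
  show "\<psi> (\<Phi> x t) = 0"
    using zero[of t] d(1) by simp
  show "flow_deriv \<Phi> \<psi> (\<Phi> x t) = 0"
  proof (rule DERIV_local_const[OF deriv])
    show "\<forall>s. \<bar>t - s\<bar> < d \<longrightarrow> \<psi> (\<Phi> x t) = \<psi> (\<Phi> x s)"
      using zero d(1) by (simp add: abs_minus_commute)
  qed (use d in auto)
qed

end

section \<open>From increments along trajectories to the weak formulation\<close>

context transport_domain
begin

text \<open>
  The formula is additive in the interval, so it only has to be checked near each time \<open>t\<close>. If the
  trajectory is in \<open>\<Omega>\<close> at time \<open>t\<close>, it is the product rule. Otherwise the trajectory is away from the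
  support of \<open>\<psi>\<close> near \<open>t\<close>, and \<open>W\<close> and \<open>G\<close> vanish there. In this way a trajectory may leave and enter
  \<open>\<Omega>\<close> any number of times.
\<close>

lemma trajectory_product_rule:
  assumes \<psi>: "\<psi> \<in> test_functions \<mu> \<Phi> \<Omega>" and "a \<le> b"
    and zero: "\<And>q. q \<in> \<rat> \<Longrightarrow> \<Phi> x q \<in> \<Omega> \<Longrightarrow> \<Phi> x q \<notin> ae_support \<mu> \<Omega> \<psi> \<Longrightarrow> \<psi> (\<Phi> x q) = 0"
    and increments: "\<And>q t1 t2. q \<in> \<rat> \<Longrightarrow> \<Phi> x q \<in> \<Omega> \<Longrightarrow>
      - tau_minus \<Phi> \<Omega> (\<Phi> x q) < ereal t1 \<and> t1 \<le> t2 \<and> ereal t2 < tau_plus \<Phi> \<Omega> (\<Phi> x q) \<Longrightarrow>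
      set_integrable lebesgue {t1..t2} (\<lambda>s. g (\<Phi> (\<Phi> x q) s)) \<and>
      h (\<Phi> (\<Phi> x q) t1) - h (\<Phi> (\<Phi> x q) t2) = (LINT s:{t1..t2}|lebesgue. g (\<Phi> (\<Phi> x q) s))"
  defines "W \<equiv> \<lambda>y. indicator \<Omega> y * (h y * \<psi> y)"
    and "G \<equiv> \<lambda>y. indicator \<Omega> y * (h y * flow_deriv \<Phi> \<psi> y - g y * \<psi> y)"
  shows "((\<lambda>s. G (\<Phi> x s)) has_integral W (\<Phi> x b) - W (\<Phi> x a)) {a..b}"
  using \<open>a \<le> b\<close>
proof (induction a b rule: Bolzano)
  case (trans a b c)
  from has_integral_combine[OF trans(3,4,1,2)] show ?case by simp
next
  case (local t)
  let ?K = "ae_support \<mu> \<Omega> \<psi>"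
  have K: "compact ?K" "?K \<subseteq> \<Omega>"
    using \<psi> by (auto simp: test_functions_def ae_support_def)
  show ?case
  proof (cases "\<Phi> x t \<in> \<Omega>")
    case True
    obtain d where d: "d > 0" "\<And>s. \<bar>s - t\<bar> \<le> d \<Longrightarrow> \<Phi> x s \<in> \<Omega>"
      by (rule remains_in_domain[OF True]) blast
    have dom: "\<Phi> x s \<in> \<Omega>" if "t - d < s" "s < t + d" for s
      by (rule d(2)) (use that in auto)
    obtain q where q: "q \<in> \<rat>" "t - d < q" "q < t"
      using Rats_dense_in_real[of "t - d" t] d(1) by auto
    have exit: "- tau_minus \<Phi> \<Omega> (\<Phi> x q) \<le> ereal (t - d - q)" "ereal (t + d - q) \<le> tau_plus \<Phi> \<Omega> (\<Phi> x q)"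
      using within_exit_times[of "t - d - q" "t + d - q" "\<Phi> x q"] dom q d(1) by auto
    have local: "set_integrable lebesgue {r..s} (\<lambda>s. g (\<Phi> x s)) \<and>
        h (\<Phi> x r) - h (\<Phi> x s) = integral {r..s} (\<lambda>s. g (\<Phi> x s))"
      if "t - d < r" "r \<le> s" "s < t + d" for r s
    proof -
      let ?\<gamma> = "\<lambda>s. g (\<Phi> x s)"
      have "- tau_minus \<Phi> \<Omega> (\<Phi> x q) < ereal (r - q)" "ereal (s - q) < tau_plus \<Phi> \<Omega> (\<Phi> x q)"
        using that by (auto intro: le_less_trans[OF exit(1)] less_le_trans[OF _ exit(2)])
      then have *: "set_integrable lebesgue {r - q..s - q} (\<lambda>s. ?\<gamma> (q + s))"
        "h (\<Phi> x r) - h (\<Phi> x s) = (LINT s:{r - q..s - q}|lebesgue. ?\<gamma> (q + s))"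
        using increments[OF q(1) dom[OF q(2)], of "r - q" "s - q"] q d(1) that by auto
      have "?\<gamma> absolutely_integrable_on {r..s}"
      proof -
        have "indicat_real {r - q..s - q} w = indicator {r..s} (q + w)" for w
          by (simp add: indicator_def algebra_simps)
        then have "integrable lebesgue (\<lambda>w. indicator {r..s} (q + w) *\<^sub>R ?\<gamma> (q + w))"
          using *(1) by (simp add: set_integrable_def)
        then show ?thesis
          using lebesgue_integrable_real_affine_iff[of 1 "\<lambda>w. indicator {r..s} w *\<^sub>R ?\<gamma> w" q]
          by (simp add: set_integrable_def)
      qed
      moreover have "(LINT s:{r - q..s - q}|lebesgue. ?\<gamma> (q + s)) = integral {r..s} ?\<gamma>"
        using set_lebesgue_integral_eq_integral(2)[OF *(1)] integral_shift_Icc_real[of "r - q" "s - q" ?\<gamma> q]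
        by (simp add: o_def)
      ultimately show ?thesis using *(2) by simp
    qed
    have "((\<lambda>s. G (\<Phi> x s)) has_integral W (\<Phi> x b) - W (\<Phi> x a)) {a..b}"
      if ab: "a \<le> t" "t \<le> b" "b - a < d" for a b
    proof -
      have in_dom: "\<Phi> x s \<in> \<Omega>" if "s \<in> {a..b}" for s
        by (rule dom) (use that ab in auto)
      have "((\<lambda>s. h (\<Phi> x s) * flow_deriv \<Phi> \<psi> (\<Phi> x s) - g (\<Phi> x s) * \<psi> (\<Phi> x s)) has_integral
          h (\<Phi> x b) * \<psi> (\<Phi> x b) - h (\<Phi> x a) * \<psi> (\<Phi> x a)) {a..b}"
      proof (rule has_integral_product_rule)
        show "set_integrable lebesgue {a..b} (\<lambda>s. g (\<Phi> x s))"
          using local[of a b] ab by auto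
        show "h (\<Phi> x r) - h (\<Phi> x s) = integral {r..s} (\<lambda>s. g (\<Phi> x s))" if "a \<le> r" "r \<le> s" "s \<le> b" for r s
          using local[of r s] ab that by auto
        show "((\<lambda>s. \<psi> (\<Phi> x s)) has_real_derivative flow_deriv \<Phi> \<psi> (\<Phi> x s)) (at s)" if "s \<in> {a..b}" for s
          by (rule test_function_along_trajectory(1)[OF \<psi> dom]) (use that ab in auto)
        show "continuous_on {a..b} (\<lambda>s. flow_deriv \<Phi> \<psi> (\<Phi> x s))"
          by (rule continuous_on_subset[OF test_function_along_trajectory(2)[OF \<psi> dom]]) (use ab in auto)
      qed (use ab in auto)
      moreover have "W (\<Phi> x a) = h (\<Phi> x a) * \<psi> (\<Phi> x a)" "W (\<Phi> x b) = h (\<Phi> x b) * \<psi> (\<Phi> x b)"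
        using in_dom[of a] in_dom[of b] ab by (simp_all add: W_def)
      ultimately show ?thesis
        by (subst has_integral_cong[of _ _ "\<lambda>s. h (\<Phi> x s) * flow_deriv \<Phi> \<psi> (\<Phi> x s) - g (\<Phi> x s) * \<psi> (\<Phi> x s)"])
           (simp_all add: G_def in_dom)
    qed
    then show ?thesis using d(1) by blast
  next
    case False
    have "open (\<Phi> x -` (- ?K))"
      by (intro open_vimage open_Compl compact_imp_closed K continuous_intros)
    moreover have "t \<in> \<Phi> x -` (- ?K)"
      using False K(2) by auto
    ultimately obtain d where "d > 0" "\<forall>s. dist s t < d \<longrightarrow> s \<in> \<Phi> x -` (- ?K)"
      unfolding open_dist by blast
    then have d: "d > 0" "\<And>s. \<bar>s - t\<bar> < d \<Longrightarrow> \<Phi> x s \<notin> ?K"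
      by (auto simp: dist_real_def)
    have vanish: "W (\<Phi> x s) = 0" "G (\<Phi> x s) = 0" if "\<bar>s - t\<bar> < d" for s
      using zero_off_support_along_trajectory[OF \<psi> compact_imp_closed[OF K(1)] zero _ d(2)[OF that]]
      by (auto simp: W_def G_def indicator_def)
    have "((\<lambda>s. G (\<Phi> x s)) has_integral W (\<Phi> x b) - W (\<Phi> x a)) {a..b}"
      if ab: "a \<le> t" "t \<le> b" "b - a < d" for a b
      using vanish ab by (auto intro!: has_integral_is_0)
    then show ?thesis using d(1) by blast
  qed
qed

lemma set_integrable_times_bounded:
  fixes f \<psi> :: "real ^ 'n \<Rightarrow> real"
  assumes f: "set_integrable \<mu> \<Omega> f" and \<psi>: "set_borel_measurable \<mu> \<Omega> \<psi>" "bounded (\<psi> ` \<Omega>)"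
  shows "set_integrable \<mu> \<Omega> (\<lambda>x. f x * \<psi> x)"
proof -
  obtain B where B: "\<And>x. x \<in> \<Omega> \<Longrightarrow> \<bar>\<psi> x\<bar> \<le> B"
    using \<psi>(2) by (auto simp: bounded_iff)
  have "(\<lambda>x. (indicator \<Omega> x *\<^sub>R f x) * (indicator \<Omega> x *\<^sub>R \<psi> x)) \<in> borel_measurable \<mu>"
    using f \<psi>(1) unfolding set_integrable_def set_borel_measurable_def
    by (intro borel_measurable_times) auto
  also have "(\<lambda>x. (indicator \<Omega> x *\<^sub>R f x) * (indicator \<Omega> x *\<^sub>R \<psi> x)) = (\<lambda>x. indicator \<Omega> x *\<^sub>R (f x * \<psi> x))"
    by (auto simp: indicator_def)
  finally show ?thesis
    unfolding set_integrable_def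
    by (intro Bochner_Integration.integrable_bound[OF integrable_mult_right[where c = B, OF f[unfolded set_integrable_def]]])
       (auto simp: indicator_def abs_mult mult.commute[of "\<bar>B\<bar>"] intro!: AE_I2 mult_left_mono order_trans[OF B])
qed

text \<open>
  Integrating over all starting points, the two sides become \<open>\<integral> G\<close> and \<open>\<integral> P - \<integral> P\<close> by invariance.
\<close>

lemma integral_zero_of_fwd_increment:
  assumes P: "integrable \<nu> P" and G: "integrable \<nu> G"
    and eq: "AE x in \<nu>. fwd 1 G x = P (\<Phi> x 1) - P x"
  shows "(\<integral>x. G x \<partial>\<nu>) = 0"
proof -
  have "P \<in> borel_measurable borel"
    using borel_measurable_integrable[OF P] by simp
  have "(\<integral>x. G x \<partial>\<nu>) = (\<integral>x. fwd 1 G x \<partial>\<nu>)"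
    using fwd_bwd_adjoint[OF G, of "\<lambda>_. 1" 1 1] by (simp add: bwd_def)
  also have "\<dots> = (\<integral>x. P (\<Phi> x 1) - P x \<partial>\<nu>)"
    by (rule integral_cong_AE) (use integrable_fwd[OF G] integrable_flow[OF P] P eq in auto)
  also have "\<dots> = 0"
    using integrable_flow[OF P, of 1] P integral_flow[OF \<open>P \<in> _\<close>] by simp
  finally show ?thesis .
qed

text \<open>
  The functions \<open>P\<close> and \<open>G\<close> below are Borel versions of \<open>f * \<psi>\<close> and \<open>f * \<psi>' - g * \<psi>\<close>, extended by
  zero. A point is good if all the almost everywhere properties hold there. The product rule uses
  them at rational times, and the replacement of its integrand by \<open>G\<close> at almost every time.
\<close>

lemma increments_imp_weak:
  assumes f: "set_integrable \<mu> \<Omega> f" and g: "set_integrable \<mu> \<Omega> g"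
    and rep: "representative \<mu> \<Omega> f h" and along: "integral_along_flow \<mu> \<Phi> \<Omega> h g"
  shows "weak_transport \<mu> \<Phi> \<Omega> f g"
  unfolding weak_transport_def
proof (intro conjI ballI g)
  fix \<psi> assume \<psi>: "\<psi> \<in> test_functions \<mu> \<Phi> \<Omega>"
  let ?\<psi>' = "flow_deriv \<Phi> \<psi>"
  have int: "set_integrable \<mu> \<Omega> (\<lambda>x. f x * \<psi> x)" "set_integrable \<mu> \<Omega> (\<lambda>x. g x * \<psi> x)"
      "set_integrable \<mu> \<Omega> (\<lambda>x. f x * ?\<psi>' x)"
    using \<psi> f g by (auto simp: test_functions_def intro: set_integrable_times_bounded)
  obtain P where P: "integrable \<nu> P" "AE x in \<nu>. P x = indicator \<Omega> x * (f x * \<psi> x)"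
    using int(1) by (rule integrable_borel_version) blast
  have diff: "set_integrable \<mu> \<Omega> (\<lambda>x. f x * ?\<psi>' x - g x * \<psi> x)"
    using int(2,3) by (simp add: set_integral_diff)
  then obtain G where G: "integrable \<nu> G" "AE x in \<nu>. G x = indicator \<Omega> x * (f x * ?\<psi>' x - g x * \<psi> x)"
    by (rule integrable_borel_version) blast
  define good where "good y \<longleftrightarrow> (y \<in> \<Omega> \<longrightarrow> y \<notin> ae_support \<mu> \<Omega> \<psi> \<longrightarrow> \<psi> y = 0) \<and>
    (y \<in> \<Omega> \<longrightarrow> (\<forall>t1 t2. - tau_minus \<Phi> \<Omega> y < ereal t1 \<and> t1 \<le> t2 \<and> ereal t2 < tau_plus \<Phi> \<Omega> y \<longrightarrow>
          set_integrable lebesgue {t1..t2} (\<lambda>s. g (\<Phi> y s)) \<and>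
          h (\<Phi> y t1) - h (\<Phi> y t2) = (LINT s:{t1..t2}|lebesgue. g (\<Phi> y s)))) \<and>
    P y = indicator \<Omega> y * (h y * \<psi> y) \<and> G y = indicator \<Omega> y * (h y * ?\<psi>' y - g y * \<psi> y)" for y
  have "AE y in \<nu>. y \<in> \<Omega> \<longrightarrow> f y = h y"
    using rep by (simp add: representative_def AE_iff)
  moreover have "AE y in \<nu>. y \<in> \<Omega> \<longrightarrow> (\<forall>t1 t2. - tau_minus \<Phi> \<Omega> y < ereal t1 \<and> t1 \<le> t2 \<and> ereal t2 < tau_plus \<Phi> \<Omega> y \<longrightarrow>
          set_integrable lebesgue {t1..t2} (\<lambda>s. g (\<Phi> y s)) \<and>
          h (\<Phi> y t1) - h (\<Phi> y t2) = (LINT s:{t1..t2}|lebesgue. g (\<Phi> y s)))"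
    using along by (simp only: integral_along_flow_def AE_iff)
  ultimately have "AE y in \<nu>. good y"
    using AE_zero_off_support[of \<psi>] P(2) G(2)
    by eventually_elim (simp add: good_def indicator_def)
  from AE_rational_times[OF this] AE_almost_all_times[OF this] AE_integrable_along_flow[OF G(1)]
  have "AE x in \<nu>. fwd 1 G x = P (\<Phi> x 1) - P x"
  proof eventually_elim
    case (elim x)
    have good: "good (\<Phi> x q)" if "q \<in> \<rat>" for q
      using elim(1) that by blast
    have "((\<lambda>s. indicator \<Omega> (\<Phi> x s) * (h (\<Phi> x s) * ?\<psi>' (\<Phi> x s) - g (\<Phi> x s) * \<psi> (\<Phi> x s))) has_integral
        indicator \<Omega> (\<Phi> x 1) * (h (\<Phi> x 1) * \<psi> (\<Phi> x 1)) - indicator \<Omega> (\<Phi> x 0) * (h (\<Phi> x 0) * \<psi> (\<Phi> x 0))) {0..1}"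
      by (rule trajectory_product_rule[OF \<psi>]) (use good in \<open>auto simp: good_def\<close>)
    then have *: "((\<lambda>s. indicator \<Omega> (\<Phi> x s) * (h (\<Phi> x s) * ?\<psi>' (\<Phi> x s) - g (\<Phi> x s) * \<psi> (\<Phi> x s))) has_integral
        P (\<Phi> x 1) - P x) {0..1}"
      using good[of 0] good[of 1] by (simp add: good_def)
    have "AE s in lebesgue. good (\<Phi> x s)"
      using elim(2) by (simp add: AE_completion_iff)
    then obtain N where N: "negligible N" "\<And>s. s \<notin> N \<Longrightarrow> good (\<Phi> x s)"
      unfolding negligible_iff_null_sets by (auto elim!: AE_E3)
    have "((\<lambda>s. G (\<Phi> x s)) has_integral P (\<Phi> x 1) - P x) {0..1}"
      by (rule has_integral_spike[OF N(1) _ *]) (use N(2) in \<open>auto simp: good_def\<close>)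
    moreover have "fwd 1 G x = integral {0..1} (\<lambda>s. G (\<Phi> x s))"
      using fwd_eq_integral[of 0 1 G x] elim(3) by simp
    ultimately show ?case
      by (simp add: integral_unique)
  qed
  from integral_zero_of_fwd_increment[OF P(1) G(1) this]
  have "(\<integral>x. G x \<partial>\<mu>) = 0"
    using borel_measurable_integrable[OF G(1)] by (simp add: integral_eq)
  also have "(\<integral>x. G x \<partial>\<mu>) = (LINT x:\<Omega>|\<mu>. f x * ?\<psi>' x - g x * \<psi> x)"
    unfolding set_lebesgue_integral_def
    by (rule integral_cong_AE)
       (use G diff in \<open>auto simp: AE_iff set_integrable_def intro!: borel_measurable_imp\<close>)
  also have "\<dots> = (LINT x:\<Omega>|\<mu>. f x * ?\<psi>' x) - (LINT x:\<Omega>|\<mu>. g x * \<psi> x)"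
    using int(2,3) by (simp add: set_integral_diff)
  finally show "(LINT x:\<Omega>|\<mu>. g x * \<psi> x) = (LINT x:\<Omega>|\<mu>. f x * ?\<psi>' x)"
    by simp
qed

end

section \<open>The two characterizations of the maximal transport operator\<close>

context transport_domain
begin

lemma between_exit_times:
  assumes "x \<in> \<Omega>" "- tau_minus \<Phi> \<Omega> x < ereal a" "ereal b < tau_plus \<Phi> \<Omega> x" and s: "a \<le> s" "s \<le> b"
  shows "\<Phi> x s \<in> \<Omega>"
proof (rule ccontr)
  assume out: "\<Phi> x s \<notin> \<Omega>"
  consider "s > 0" | "s < 0" | "s = 0" by linarith
  then show False
  proof cases
    case 1
    then have "tau_plus \<Phi> \<Omega> x \<le> ereal s"
      unfolding tau_plus_def using out by (intro Inf_lower) auto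
    also have "\<dots> \<le> ereal b" using s by simp
    finally show False using assms(3) by simp
  next
    case 2
    then have "tau_minus \<Phi> \<Omega> x \<le> ereal (- s)"
      unfolding tau_minus_def using out by (intro Inf_lower) auto
    then have "- ereal (- s) \<le> - tau_minus \<Phi> \<Omega> x"
      by (simp only: ereal_minus_le_minus)
    then have "ereal s \<le> - tau_minus \<Phi> \<Omega> x"
      by simp
    moreover have "ereal a \<le> ereal s" using s by simp
    ultimately show False using assms(2) by (meson leD order_trans)
  next
    case 3
    then show False using out assms(1) by simp
  qed
qed

text \<open>
  The integrals over \<open>\<Omega>\<close> with respect to \<open>\<mu>\<close> in the weak formulation are integrals over the whole
  space with respect to \<open>\<nu>\<close>.
\<close>

lemma integral_borel_version:
  fixes f f' \<psi> :: "real ^ 'n \<Rightarrow> real"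
  assumes f: "set_integrable \<mu> \<Omega> f"
    and f': "integrable \<nu> f'" "AE x in \<nu>. f' x = indicator \<Omega> x * f x"
    and \<psi>: "\<psi> \<in> borel_measurable borel" "bounded (\<psi> ` \<Omega>)"
  shows "(LINT x:\<Omega>|\<mu>. f x * \<psi> x) = (\<integral>x. f' x * \<psi> x \<partial>\<nu>)"
proof -
  have [measurable]: "f' \<in> borel_measurable borel" "\<psi> \<in> borel_measurable borel"
    using borel_measurable_integrable[OF f'(1)] \<psi> by simp_all
  have "set_borel_measurable \<mu> \<Omega> \<psi>"
    unfolding set_borel_measurable_def by (intro borel_measurable_imp) measurable
  from set_integrable_times_bounded[OF f this \<psi>(2)]
  have "(\<lambda>x. indicator \<Omega> x *\<^sub>R (f x * \<psi> x)) \<in> borel_measurable \<mu>"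
    by (simp add: set_integrable_def)
  then have "(LINT x:\<Omega>|\<mu>. f x * \<psi> x) = (\<integral>x. f' x * \<psi> x \<partial>\<mu>)"
    unfolding set_lebesgue_integral_def
    by (rule integral_cong_AE) (use f'(2) in \<open>auto simp: AE_iff intro!: borel_measurable_imp\<close>)
  then show ?thesis
    by (simp add: integral_eq)
qed

lemma weak_transport_imp_weak_eq:
  assumes f: "set_integrable \<mu> \<Omega> f" and weak: "weak_transport \<mu> \<Phi> \<Omega> f g"
    and f': "integrable \<nu> f'" "AE x in \<nu>. f' x = indicator \<Omega> x * f x"
    and g': "integrable \<nu> g'" "AE x in \<nu>. g' x = indicator \<Omega> x * g x"
  shows "weak_eq f' g'"
  unfolding weak_eq_def
proof (intro conjI ballI impI f'(1) g'(1))
  fix \<psi> assume \<psi>: "\<psi> \<in> test_functions \<mu> \<Phi> \<Omega>" "\<psi> \<in> borel_measurable borel" "flow_deriv \<Phi> \<psi> \<in> borel_measurable borel"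
  then have "bounded (\<psi> ` \<Omega>)" "bounded (flow_deriv \<Phi> \<psi> ` \<Omega>)"
    by (auto simp: test_functions_def)
  moreover have "set_integrable \<mu> \<Omega> g"
      "(LINT x:\<Omega>|\<mu>. g x * \<psi> x) = (LINT x:\<Omega>|\<mu>. f x * flow_deriv \<Phi> \<psi> x)"
    using weak \<psi>(1) by (auto simp: weak_transport_def)
  ultimately show "(\<integral>x. g' x * \<psi> x \<partial>\<nu>) = (\<integral>x. f' x * flow_deriv \<Phi> \<psi> x \<partial>\<nu>)"
    using integral_borel_version[OF _ g' \<psi>(2)] integral_borel_version[OF f f' \<psi>(3)] by simp
qed

lemma weak_transport_unique:
  assumes f: "set_integrable \<mu> \<Omega> f"
    and g1: "weak_transport \<mu> \<Phi> \<Omega> f g1" and g2: "weak_transport \<mu> \<Phi> \<Omega> f g2"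
  shows "AE x\<in>\<Omega> in \<mu>. g1 x = g2 x"
proof -
  have int: "set_integrable \<mu> \<Omega> g1" "set_integrable \<mu> \<Omega> g2"
    using g1 g2 by (auto simp: weak_transport_def)
  obtain f' where f': "integrable \<nu> f'" "AE x in \<nu>. f' x = indicator \<Omega> x * f x"
    using f by (rule integrable_borel_version) blast
  obtain g1' where g1': "integrable \<nu> g1'" "AE x in \<nu>. g1' x = indicator \<Omega> x * g1 x"
    using int(1) by (rule integrable_borel_version) blast
  obtain g2' where g2': "integrable \<nu> g2'" "AE x in \<nu>. g2' x = indicator \<Omega> x * g2 x"
    using int(2) by (rule integrable_borel_version) blast
  show ?thesis
    unfolding AE_iff
    using weak_eq_unique[OF weak_transport_imp_weak_eq[OF f g1 f' g1'] weak_transport_imp_weak_eq[OF f g2 f' g2']]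
      g1'(2) g2'(2)
    by eventually_elim auto
qed

lemma weak_imp_increments:
  assumes f: "set_integrable \<mu> \<Omega> f" and g: "weak_transport \<mu> \<Phi> \<Omega> f g"
  shows "\<exists>g h. set_integrable \<mu> \<Omega> g \<and> representative \<mu> \<Omega> f h \<and> integral_along_flow \<mu> \<Phi> \<Omega> h g"
proof -
  have int: "set_integrable \<mu> \<Omega> g"
    using g by (auto simp: weak_transport_def)
  obtain f' where f': "integrable \<nu> f'" "AE x in \<nu>. f' x = indicator \<Omega> x * f x"
    using f by (rule integrable_borel_version) blast
  obtain g' where g': "integrable \<nu> g'" "AE x in \<nu>. g' x = indicator \<Omega> x * g x"
    using int by (rule integrable_borel_version) blast
  have [measurable]: "g' \<in> borel_measurable borel"
    using borel_measurable_integrable[OF g'(1)] by simp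
  have "set_integrable \<nu> \<Omega> g'"
    unfolding set_integrable_def by (intro integrable_mult_indicator g'(1)) (simp add: sets_eq)
  then have "set_integrable \<mu> \<Omega> g'"
    unfolding set_integrable_def by (subst integrable_iff) auto
  moreover have "representative \<mu> \<Omega> f (rep f')"
    unfolding representative_def AE_iff using AE_rep_eq[OF f'(1)] f'(2)
    by eventually_elim simp
  moreover have "integral_along_flow \<mu> \<Phi> \<Omega> (rep f') g'"
    unfolding integral_along_flow_def AE_iff
    using weak_eq_imp_rep_increments[OF weak_transport_imp_weak_eq[OF f g f' g']]
      AE_integrable_along_flow[OF g'(1)]
  proof eventually_elim
    case (elim x)
    show ?case
    proof (intro impI allI, elim conjE)
      fix t1 t2
      assume x: "x \<in> \<Omega>" and t: "- tau_minus \<Phi> \<Omega> x < ereal t1" "t1 \<le> t2" "ereal t2 < tau_plus \<Phi> \<Omega> x"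
      have "\<forall>s\<in>{t1..t2}. \<Phi> x s \<in> \<Omega>"
        using between_exit_times[OF x t(1,3)] by auto
      with elim(1) t(2) have eq: "rep f' (\<Phi> x t1) - rep f' (\<Phi> x t2) = integral {t1..t2} (\<lambda>s. g' (\<Phi> x s))"
        by blast
      have int: "set_integrable lebesgue {t1..t2} (\<lambda>s. g' (\<Phi> x s))"
        using elim(2)[rule_format, of t1 t2] unfolding set_integrable_def
        by (subst integrable_completion) auto
      show "set_integrable lebesgue {t1..t2} (\<lambda>s. g' (\<Phi> x s)) \<and>
          rep f' (\<Phi> x t1) - rep f' (\<Phi> x t2) = (LINT s:{t1..t2}|lebesgue. g' (\<Phi> x s))"
        using int eq set_lebesgue_integral_eq_integral(2)[OF int] by simp
    qed
  qed
  ultimately show ?thesis by blast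
qed

end

text \<open>
  Finiteness on balls makes the underlying Borel measure \<open>\<sigma>\<close>-finite, and the preimage of a set under
  the flow by \<open>t\<close> is its image under the flow by \<open>- t\<close>, so the hypothesis on images applies.
\<close>

lemma transport_domain_of_radon:
  fixes \<mu> :: "(real ^ 'n) measure"
  assumes radon: "radon_measure \<mu>"
    and lipschitz: "\<exists>L. L-lipschitz_on UNIV F"
    and flow: "is_flow F \<Phi>"
    and invariant: "flow_invariant \<mu> \<Phi>"
    and open_domain: "open \<Omega>"
  shows "\<exists>\<nu>. transport_domain \<nu> \<Phi> \<mu> \<Omega>"
proof -
  obtain L where L: "L-lipschitz_on UNIV F"
    using lipschitz by blast
  have ode: "\<Phi> x 0 = x" "(\<Phi> x has_vector_derivative F (\<Phi> x t)) (at t)" for x t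
    using flow by (auto simp: is_flow_def)
  note add = lipschitz_flow_add[where \<Phi> = \<Phi>, OF L ode] and cont = lipschitz_flow_continuous[where \<Phi> = \<Phi>, OF L ode]
  obtain \<nu> :: "(real ^ 'n) measure" where \<nu>: "sets \<nu> = sets borel" "\<mu> = \<nu> \<or> \<mu> = completion \<nu>"
    using radon by (auto simp: radon_measure_def)
  have borel_sets: "A \<in> sets \<mu>" "emeasure \<mu> A = emeasure \<nu> A" if "A \<in> sets borel" for A
    using that \<nu> by (auto simp: emeasure_completion)
  have preserve: "emeasure \<nu> ((\<lambda>x. \<Phi> x t) -` A) = emeasure \<nu> A" if A: "A \<in> sets borel" for A t
  proof -
    have image: "(\<lambda>x. \<Phi> x t) -` A = (\<lambda>x. \<Phi> x (- t)) ` A"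
    proof (intro set_eqI iffI)
      fix x assume "x \<in> (\<lambda>x. \<Phi> x t) -` A"
      then have "\<Phi> x t \<in> A" "x = \<Phi> (\<Phi> x t) (- t)"
        by (simp_all add: add ode)
      then show "x \<in> (\<lambda>x. \<Phi> x (- t)) ` A" by blast
    qed (auto simp: add ode)
    have "continuous_on UNIV (\<lambda>x. \<Phi> x t)"
      using continuous_on_compose2[OF cont, of UNIV "\<lambda>x. (x, t)"]
      by (simp add: continuous_on_Pair)
    then have "(\<lambda>x. \<Phi> x t) \<in> borel_measurable borel"
      by (rule borel_measurable_continuous_onI)
    then have "(\<lambda>x. \<Phi> x t) -` A \<in> sets borel"
      using measurable_sets[of _ borel borel A] A by fastforce
    then show ?thesis
      using invariant borel_sets A unfolding flow_invariant_def image by metis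
  qed
  have "sigma_finite_measure \<nu>"
  proof
    have "emeasure \<nu> (cball 0 (real n)) \<noteq> \<infinity>" for n
    proof -
      have "emeasure \<mu> (cball 0 (real n)) < \<infinity>"
        using radon compact_cball unfolding radon_measure_def by blast
      then show ?thesis
        using borel_sets(2)[of "cball 0 (real n)"] by simp
    qed
    moreover have "\<exists>n. x \<in> cball (0 :: real ^ 'n) (real n)" for x
      using real_arch_simple[of "norm x"] by simp
    ultimately show "\<exists>A. countable A \<and> A \<subseteq> sets \<nu> \<and> \<Union>A = space \<nu> \<and> (\<forall>a\<in>A. emeasure \<nu> a \<noteq> \<infinity>)"
      using sets_eq_imp_space_eq[OF \<nu>(1)]
      by (intro exI[of _ "range (\<lambda>n. cball 0 (real n))"]) (auto simp: \<nu>(1))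
  qed
  then have "transport_domain \<nu> \<Phi> \<mu> \<Omega>"
    using \<nu> cont ode add preserve open_domain
    by (simp add: transport_domain_def transport_domain_axioms_def
        measure_preserving_flow_def measure_preserving_flow_axioms_def)
  then show ?thesis by blast
qed

theorem theorem3p6:
  fixes \<mu> :: "(real ^ 'n) measure"
    and F :: "real ^ 'n \<Rightarrow> real ^ 'n"
    and \<Phi> :: "real ^ 'n \<Rightarrow> real \<Rightarrow> real ^ 'n"
    and \<Omega> :: "(real ^ 'n) set"
    and f :: "real ^ 'n \<Rightarrow> real"
  assumes radon: "radon_measure \<mu>"
    and lipschitz: "\<exists>L. L-lipschitz_on UNIV F"
    and flow: "is_flow F \<Phi>"
    and invariant: "flow_invariant \<mu> \<Phi>"
    and open_domain: "open \<Omega>"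
    and f_L1: "set_integrable \<mu> \<Omega> f"
  shows "((\<exists>g fsharp. set_integrable \<mu> \<Omega> g \<and> representative \<mu> \<Omega> f fsharp \<and>
             integral_along_flow \<mu> \<Phi> \<Omega> fsharp g)
           \<longleftrightarrow> f \<in> T_max_domain \<mu> \<Phi> \<Omega>) \<and>
         (\<forall>g fsharp. set_integrable \<mu> \<Omega> g \<and> representative \<mu> \<Omega> f fsharp \<and>
             integral_along_flow \<mu> \<Phi> \<Omega> fsharp g
           \<longrightarrow> (AE x\<in>\<Omega> in \<mu>. g x = T_max \<mu> \<Phi> \<Omega> f x))"
proof -
  obtain \<nu> where "transport_domain \<nu> \<Phi> \<mu> \<Omega>"
    using transport_domain_of_radon[OF radon lipschitz flow invariant open_domain] by blast
  then interpret transport_domain \<nu> \<Phi> \<mu> \<Omega> .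
  have weak: "weak_transport \<mu> \<Phi> \<Omega> f g"
    if "set_integrable \<mu> \<Omega> g \<and> representative \<mu> \<Omega> f h \<and> integral_along_flow \<mu> \<Phi> \<Omega> h g" for g h
    using that increments_imp_weak[OF f_L1] by blast
  have T_max: "weak_transport \<mu> \<Phi> \<Omega> f (T_max \<mu> \<Phi> \<Omega> f)" if "weak_transport \<mu> \<Phi> \<Omega> f g" for g
    unfolding T_max_def using someI[of "weak_transport \<mu> \<Phi> \<Omega> f"] that by blast
  show ?thesis
  proof (intro conjI allI impI iffI)
    assume "\<exists>g h. set_integrable \<mu> \<Omega> g \<and> representative \<mu> \<Omega> f h \<and> integral_along_flow \<mu> \<Phi> \<Omega> h g"
    then show "f \<in> T_max_domain \<mu> \<Phi> \<Omega>"
      unfolding T_max_domain_def using f_L1 weak by blast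
  next
    assume "f \<in> T_max_domain \<mu> \<Phi> \<Omega>"
    then show "\<exists>g h. set_integrable \<mu> \<Omega> g \<and> representative \<mu> \<Omega> f h \<and> integral_along_flow \<mu> \<Phi> \<Omega> h g"
      unfolding T_max_domain_def using weak_imp_increments[OF f_L1] by blast
  next
    fix g h assume "set_integrable \<mu> \<Omega> g \<and> representative \<mu> \<Omega> f h \<and> integral_along_flow \<mu> \<Phi> \<Omega> h g"
    then have "weak_transport \<mu> \<Phi> \<Omega> f g" by (rule weak)
    then show "AE x\<in>\<Omega> in \<mu>. g x = T_max \<mu> \<Phi> \<Omega> f x"
      using weak_transport_unique[OF f_L1] T_max by blast
  qed
qed

end
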